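(* Let $d<\infty$ and let $V,W\subset\mathbb{B}_d$ be analytic discs attached to the unit sphere with embedding maps $f$ and $g$ respectively. If $\mathcal{M}_f$ and $\mathcal{M}_g$ are isomorphic as algebras, then there exists an automorphism $\mu$ of the unit disc $\mathbb{D}$ such that $\mathcal{M}_f=\mathcal{M}_{g\circ\mu}$ with equivalent norms.
   Context: $\mathbb{D}$ is the open unit disc, $\mathbb{T}$ the unit circle, $\mathbb{B}_d$ the open Euclidean unit ball of $\mathbb{C}^d$. The Drury–Arveson space $H^2_d$ is the reproducing kernel Hilbert space on $\mathbb{B}_d$ with kernel $1/(1-\langle z,w\rangle)$, and $\mathcal{M}_d$ denotes its multiplier algebra. A variety is a subset of $\mathbb{B}_d$ which is the common zero set of some family of functions from $\mathcal{M}_d$. An analytic disc attached to the unit sphere is a variety $V\subset\mathbb{B}_d$ ($d<\infty$) for which there is an injective analytic map $f:\mathbb{D}\to\mathbb{B}_d$ with $f'(z)\neq0$ for all $z\in\mathbb{D}$, $V=f(\mathbb{D})$, $f$ extends to a $C^2$ map on $\overline{\mathbb{D}}$, and for $x\in\overline{\mathbb{D}}$, $\|f(x)\|=1$ iff $|x|=1$; such $f$ is called an embedding map of $V$. For a map $h:\mathbb{D}\to\mathbb{B}_d$ (in particular $h=f$ or $h=g\circ\mu$), $\mathcal{H}_h$ is the reproducing kernel Hilbert space on $\mathbb{D}$ with kernel $k^h(z,w)=1/(1-\langle h(z),h(w)\rangle)$, and $\mathcal{M}_h$ is its multiplier algebra; for an embedding map $f$, equivalently $\mathcal{M}_f=\{\varphi\circ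 f:\varphi\in\mathcal{M}_d\}$ with the quotient norm. *)

theory Defs
  imports "HOL-Analysis.Analysis"
begin

definition pos_kernel :: "'a set \<Rightarrow> ('a \<Rightarrow> 'a \<Rightarrow> complex) \<Rightarrow> bool" where
  "pos_kernel X K \<longleftrightarrow>
     (\<forall>F c. finite F \<and> F \<subseteq> X \<longrightarrow>
        (let s = (\<Sum>x\<in>F. \<Sum>y\<in>F. c x * cnj (c y) * K x y) in Im s = 0 \<and> Re s \<ge> 0))"

text \<open>The RKHS of a positive kernel K on X (Aronszajn): h belongs to it iff
  C^2 K(z,w) - h(z) conj(h(w)) is positive for some C, and its norm is the least such C \<ge> 0.
  Functions are normalised to vanish outside X.\<close>
definition rkhs :: "'a set \<Rightarrow> ('a \<Rightarrow> 'a \<Rightarrow> complex) \<Rightarrow> ('a \<Rightarrow> complex) set" where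
  "rkhs X K = {h. (\<forall>x. x \<notin> X \<longrightarrow> h x = 0) \<and>
     (\<exists>C::real. pos_kernel X (\<lambda>z w. complex_of_real (C^2) * K z w - h z * cnj (h w)))}"

definition rkhs_norm :: "'a set \<Rightarrow> ('a \<Rightarrow> 'a \<Rightarrow> complex) \<Rightarrow> ('a \<Rightarrow> complex) \<Rightarrow> real" where
  "rkhs_norm X K h = Inf {C::real. C \<ge> 0 \<and>
     pos_kernel X (\<lambda>z w. complex_of_real (C^2) * K z w - h z * cnj (h w))}"

definition mult_alg :: "'a set \<Rightarrow> ('a \<Rightarrow> 'a \<Rightarrow> complex) \<Rightarrow> ('a \<Rightarrow> complex) set" where
  "mult_alg X K = {\<phi>. (\<forall>x. x \<notin> X \<longrightarrow> \<phi> x = 0) \<and>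
     (\<forall>h\<in>rkhs X K. (\<lambda>z. \<phi> z * h z) \<in> rkhs X K)}"

definition mult_norm :: "'a set \<Rightarrow> ('a \<Rightarrow> 'a \<Rightarrow> complex) \<Rightarrow> ('a \<Rightarrow> complex) \<Rightarrow> real" where
  "mult_norm X K \<phi> = Sup {rkhs_norm X K (\<lambda>z. \<phi> z * h z) | h. h \<in> rkhs X K \<and> rkhs_norm X K h \<le> 1}"

definition cinner :: "complex ^ 'n \<Rightarrow> complex ^ 'n \<Rightarrow> complex" where
  "cinner z w = (\<Sum>i\<in>UNIV. z $ i * cnj (w $ i))"

definition unit_ball :: "(complex ^ 'n) set" where
  "unit_ball = ball 0 1"

definition DA_kernel :: "complex ^ 'n \<Rightarrow> complex ^ 'n \<Rightarrow> complex" where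
  "DA_kernel z w = 1 / (1 - cinner z w)"

definition M_d :: "(complex ^ 'n \<Rightarrow> complex) set" where
  "M_d = mult_alg unit_ball DA_kernel"

definition is_variety :: "(complex ^ 'n) set \<Rightarrow> bool" where
  "is_variety V \<longleftrightarrow> (\<exists>S. S \<subseteq> M_d \<and> V = {z \<in> unit_ball. \<forall>\<phi>\<in>S. \<phi> z = 0})"

definition unit_disc :: "complex set" where
  "unit_disc = ball 0 1"

definition C2_on_closed_disc :: "(complex \<Rightarrow> complex ^ 'n) \<Rightarrow> bool" where
  "C2_on_closed_disc f \<longleftrightarrow>
     (\<exists>U (f1 :: complex \<Rightarrow> complex \<Rightarrow>\<^sub>L (complex ^ 'n))
        (f2 :: complex \<Rightarrow> complex \<Rightarrow>\<^sub>L (complex \<Rightarrow>\<^sub>L (complex ^ 'n))).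
        open U \<and> cball 0 1 \<subseteq> U \<and>
        (\<forall>x\<in>U. (f has_derivative blinfun_apply (f1 x)) (at x)) \<and>
        (\<forall>x\<in>U. (f1 has_derivative blinfun_apply (f2 x)) (at x)) \<and>
        continuous_on U f2)"

definition embedding_map :: "(complex \<Rightarrow> complex ^ 'n) \<Rightarrow> (complex ^ 'n) set \<Rightarrow> bool" where
  "embedding_map f V \<longleftrightarrow>
     is_variety V \<and>
     inj_on f unit_disc \<and>
     (\<forall>i. (\<lambda>z. f z $ i) holomorphic_on unit_disc) \<and>
     (\<forall>z\<in>unit_disc. \<exists>i. deriv (\<lambda>w. f w $ i) z \<noteq> 0) \<and>
     V = f ` unit_disc \<and>
     C2_on_closed_disc f \<and>
     (\<forall>x\<in>cball 0 1. norm (f x) = 1 \<longleftrightarrow> norm x = 1)"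

definition disc_kernel :: "(complex \<Rightarrow> complex ^ 'n) \<Rightarrow> complex \<Rightarrow> complex \<Rightarrow> complex" where
  "disc_kernel h z w = 1 / (1 - cinner (h z) (h w))"

definition M_of :: "(complex \<Rightarrow> complex ^ 'n) \<Rightarrow> (complex \<Rightarrow> complex) set" where
  "M_of h = mult_alg unit_disc (disc_kernel h)"

definition M_norm :: "(complex \<Rightarrow> complex ^ 'n) \<Rightarrow> (complex \<Rightarrow> complex) \<Rightarrow> real" where
  "M_norm h \<phi> = mult_norm unit_disc (disc_kernel h) \<phi>"

definition alg_iso :: "(('a \<Rightarrow> complex) \<Rightarrow> ('b \<Rightarrow> complex)) \<Rightarrow> ('a \<Rightarrow> complex) set \<Rightarrow> ('b \<Rightarrow> complex) set \<Rightarrow> bool" where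
  "alg_iso \<Phi> A B \<longleftrightarrow> bij_betw \<Phi> A B \<and>
     (\<forall>a\<in>A. \<forall>b\<in>A. \<Phi> (\<lambda>z. a z + b z) = (\<lambda>z. \<Phi> a z + \<Phi> b z)) \<and>
     (\<forall>a\<in>A. \<forall>c. \<Phi> (\<lambda>z. c * a z) = (\<lambda>z. c * \<Phi> a z)) \<and>
     (\<forall>a\<in>A. \<forall>b\<in>A. \<Phi> (\<lambda>z. a z * b z) = (\<lambda>z. \<Phi> a z * \<Phi> b z))"

definition disc_automorphism :: "(complex \<Rightarrow> complex) \<Rightarrow> bool" where
  "disc_automorphism \<mu> \<longleftrightarrow> \<mu> holomorphic_on unit_disc \<and> bij_betw \<mu> unit_disc unit_disc"

end

theory Submission
  imports Defs "HOL-Complex_Analysis.Complex_Analysis"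
begin

text \<open>An isomorphism \<open>\<Phi> : M\<^sub>f \<rightarrow> M\<^sub>g\<close> turns each evaluation at \<open>z \<in> \<D>\<close> into a character \<open>\<rho>\<^sub>z\<close> of \<open>M\<^sub>f\<close>. The point
  \<open>\<lambda>(z) = (\<rho>\<^sub>z(f\<^sub>1), ..., \<rho>\<^sub>z(f\<^sub>d))\<close> lies in the closed ball because \<open>1 - \<langle>f, w\<rangle>\<close> is invertible in \<open>M\<^sub>f\<close> for
  \<open>|w| < 1\<close>, in the open ball by the maximum principle, and in \<open>V\<close> because \<open>V\<close> is a variety. A
  character over a point of the open ball is determined by that point, since Gleason's problem is solvable with
  multipliers; so \<open>\<rho>\<^sub>z\<close> is evaluation at the \<open>\<mu>(z)\<close> with \<open>f(\<mu>(z)) = \<lambda>(z)\<close>, and \<open>\<Phi>\<close> is composition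
  with \<open>\<mu>\<close>. The same for \<open>\<Phi>\<inverse>\<close> gives the inverse of \<open>\<mu>\<close>, which is the automorphism sought. Equal algebras have
  equivalent norms by the closed graph theorem.

  Gleason's problem is an instance of Leech's theorem for complete Pick kernels. That theorem is obtained by extending
  tangential data one point at a time, each step being a Hahn-Banach extension, and Zorn's lemma.\<close>

section \<open>Positive kernels\<close>

text \<open>An abstract isomorphism carries no weak-star continuity, so the characters it induces
  cannot be determined by approximating multipliers by polynomials. Every fact about a character is
  instead read off from a finite identity among multipliers: an inverse, or a division whose
  quotients are again multipliers. Hence Gleason's problem must be solved exactly, and Leech's
  theorem supplies the quotients all at once.

  No Hilbert space is constructed. A vector of the kernel space is represented by finitely many
  coefficients, its norm is read off from a hermitian form, and membership in a ball is positivity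
  of a kernel. Hahn-Banach takes the place of orthogonal projection, and closedness of balls under
  pointwise limits that of completeness.

  The variety hypothesis enters through Gleason's problem on the whole ball, whose quotients are
  then composed with \<open>f\<close>. In this way no multiplier on the disc has to be lifted to the
  ball.\<close>

definition kform :: "('a \<Rightarrow> 'a \<Rightarrow> complex) \<Rightarrow> 'a set \<Rightarrow> ('a \<Rightarrow> complex) \<Rightarrow> ('a \<Rightarrow> complex) \<Rightarrow> complex" where
  "kform K F c d = (\<Sum>x\<in>F. \<Sum>y\<in>F. c x * cnj (d y) * K x y)"

lemma pos_kernel_iff:
  "pos_kernel X K \<longleftrightarrow> (\<forall>F c. finite F \<longrightarrow> F \<subseteq> X \<longrightarrow> kform K F c c \<in> \<real>\<^sub>\<ge>\<^sub>0)"
  by (auto simp: pos_kernel_def kform_def complex_nonneg_Reals_iff Let_def)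

lemma pos_kernelD: "pos_kernel X K \<Longrightarrow> finite F \<Longrightarrow> F \<subseteq> X \<Longrightarrow> kform K F c c \<in> \<real>\<^sub>\<ge>\<^sub>0"
  by (simp add: pos_kernel_iff)

lemma pos_kernelI: "(\<And>F c. finite F \<Longrightarrow> F \<subseteq> X \<Longrightarrow> kform K F c c \<in> \<real>\<^sub>\<ge>\<^sub>0) \<Longrightarrow> pos_kernel X K"
  by (simp add: pos_kernel_iff)

lemma pos_kernel_cong:
  assumes "\<And>x y. x \<in> X \<Longrightarrow> y \<in> X \<Longrightarrow> K x y = L x y"
  shows "pos_kernel X K \<longleftrightarrow> pos_kernel X L"
proof -
  have "kform K F c c = kform L F c c" if "F \<subseteq> X" for F c
    unfolding kform_def using that assms by (intro sum.cong refl) (auto simp: subset_iff)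
  then show ?thesis by (auto simp: pos_kernel_iff)
qed

lemma pos_kernel_eqI:
  assumes "pos_kernel X K" "\<And>x y. x \<in> X \<Longrightarrow> y \<in> X \<Longrightarrow> K x y = L x y"
  shows "pos_kernel X L"
  using assms pos_kernel_cong[of X K L] by blast

lemma pos_kernel_subset: "pos_kernel X K \<Longrightarrow> Y \<subseteq> X \<Longrightarrow> pos_kernel Y K"
  by (auto simp: pos_kernel_iff)

lemma pos_kernel_add:
  assumes "pos_kernel X K" "pos_kernel X L"
  shows "pos_kernel X (\<lambda>x y. K x y + L x y)"
proof (rule pos_kernelI)
  fix F c assume F: "finite F" "F \<subseteq> X"
  have "kform (\<lambda>x y. K x y + L x y) F c c = kform K F c c + kform L F c c"
    by (simp add: kform_def algebra_simps sum.distrib)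
  then show "kform (\<lambda>x y. K x y + L x y) F c c \<in> \<real>\<^sub>\<ge>\<^sub>0"
    using pos_kernelD[OF assms(1) F] pos_kernelD[OF assms(2) F] by (metis nonneg_Reals_add_I)
qed

lemma pos_kernel_zero: "pos_kernel X (\<lambda>x y. 0)"
  by (rule pos_kernelI) (simp add: kform_def)

lemma pos_kernel_sum:
  assumes "\<And>i. i \<in> I \<Longrightarrow> pos_kernel X (K i)"
  shows "pos_kernel X (\<lambda>x y. \<Sum>i\<in>I. K i x y)"
  using assms by (induction I rule: infinite_finite_induct) (auto intro: pos_kernel_zero pos_kernel_add)

lemma pos_kernel_conj:
  assumes "pos_kernel X K"
  shows "pos_kernel X (\<lambda>x y. g x * cnj (g y) * K x y)"
proof (rule pos_kernelI)
  fix F c assume F: "finite F" "F \<subseteq> X"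
  have "kform (\<lambda>x y. g x * cnj (g y) * K x y) F c c = kform K F (\<lambda>x. c x * g x) (\<lambda>x. c x * g x)"
    by (simp add: kform_def algebra_simps)
  then show "kform (\<lambda>x y. g x * cnj (g y) * K x y) F c c \<in> \<real>\<^sub>\<ge>\<^sub>0"
    using pos_kernelD[OF assms F] by simp
qed

lemma pos_kernel_scale:
  assumes "pos_kernel X K" "0 \<le> r"
  shows "pos_kernel X (\<lambda>x y. complex_of_real r * K x y)"
proof -
  have "complex_of_real (sqrt r) * cnj (complex_of_real (sqrt r)) = complex_of_real r"
    using assms(2) by (simp flip: of_real_mult)
  then show ?thesis
    using pos_kernel_conj[OF assms(1), of "\<lambda>_. complex_of_real (sqrt r)"] by simp
qed

lemma pos_kernel_one: "pos_kernel X (\<lambda>x y. 1)"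
proof (rule pos_kernelI)
  fix F :: "'a set" and c :: "'a \<Rightarrow> complex"
  have "kform (\<lambda>x y. 1) F c c = (\<Sum>x\<in>F. c x) * cnj (\<Sum>x\<in>F. c x)"
    by (simp add: kform_def sum_product)
  also have "\<dots> = complex_of_real ((cmod (\<Sum>x\<in>F. c x))\<^sup>2)"
    by (simp only: complex_norm_square)
  finally show "kform (\<lambda>x y. 1) F c c \<in> \<real>\<^sub>\<ge>\<^sub>0" by simp
qed

lemma pos_kernel_limit:
  assumes "\<And>n. pos_kernel X (K n)"
    and "\<And>x y. x \<in> X \<Longrightarrow> y \<in> X \<Longrightarrow> (\<lambda>n. K n x y) \<longlonglongrightarrow> L x y"
  shows "pos_kernel X L"
proof (rule pos_kernelI)
  fix F c assume F: "finite F" "F \<subseteq> X"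
  have "(\<lambda>n. kform (K n) F c c) \<longlonglongrightarrow> kform L F c c"
    unfolding kform_def using F by (intro tendsto_sum tendsto_mult tendsto_const assms(2)) auto
  then show "kform L F c c \<in> \<real>\<^sub>\<ge>\<^sub>0"
    using pos_kernelD[OF assms(1) F]
    by (intro Lim_in_closed_set[OF closed_nonneg_Reals_complex _ sequentially_bot]) auto
qed

lemma pos_kernel_pullback:
  assumes K: "pos_kernel X K" and m: "m ` Y \<subseteq> X"
  shows "pos_kernel Y (\<lambda>x y. K (m x) (m y))"
proof (rule pos_kernelI)
  fix F and c :: "_ \<Rightarrow> complex" assume F: "finite F" "F \<subseteq> Y"
  \<comment> \<open>The map \<open>m\<close> need not be injective: coefficients over a common image
    point are added, which turns the form over \<open>F\<close> into the form over its
    image.\<close>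
  define d where "d u = (\<Sum>x\<in>{x\<in>F. m x = u}. c x)" for u
  have inner: "(\<Sum>y\<in>F. cnj (c y) * k (m y)) = (\<Sum>v\<in>m ` F. cnj (d v) * k v)" for k
  proof -
    have "(\<Sum>y\<in>{x\<in>F. m x = v}. cnj (c y) * k (m y)) = cnj (d v) * k v" for v
      unfolding d_def cnj_sum sum_distrib_right by (rule sum.cong) auto
    then show ?thesis
      using sum.image_gen[OF F(1), of "\<lambda>y. cnj (c y) * k (m y)" m] by simp
  qed
  have outer: "(\<Sum>y\<in>F. (c y) * k (m y)) = (\<Sum>v\<in>m ` F. (d v) * k v)" for k
  proof -
    have "(\<Sum>y\<in>{x\<in>F. m x = v}. (c y) * k (m y)) = (d v) * k v" for v
      unfolding d_def sum_distrib_right by (rule sum.cong) auto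
    then show ?thesis
      using sum.image_gen[OF F(1), of "\<lambda>y. (c y) * k (m y)" m] by simp
  qed
  have "kform (\<lambda>x y. K (m x) (m y)) F c c = (\<Sum>x\<in>F. c x * (\<Sum>y\<in>F. cnj (c y) * K (m x) (m y)))"
    by (simp add: kform_def sum_distrib_left mult.assoc)
  also have "\<dots> = (\<Sum>x\<in>F. c x * (\<Sum>v\<in>m ` F. cnj (d v) * K (m x) v))"
    by (simp add: inner)
  also have "\<dots> = (\<Sum>u\<in>m ` F. d u * (\<Sum>v\<in>m ` F. cnj (d v) * K u v))"
    by (rule outer)
  also have "\<dots> = kform K (m ` F) d d"
    by (simp add: kform_def sum_distrib_left mult.assoc)
  finally show "kform (\<lambda>x y. K (m x) (m y)) F c c \<in> \<real>\<^sub>\<ge>\<^sub>0"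
    using pos_kernelD[OF K, of "m ` F" d] F m by auto
qed

section \<open>The Cauchy-Schwarz inequality and the norms of coefficient vectors\<close>

text \<open>Positivity is known only on the diagonal of the form. Reality of the quadratic at 1, -1
  and \<i> already forces hermitian symmetry, and the choice \<open>t = s * b\<close> with real
  \<open>s\<close> leaves a real quadratic whose discriminant gives the bound.\<close>

lemma hermitian_discriminant:
  fixes a b e p :: complex
  assumes H: "\<And>t. a + cnj t * b + t * e + t * cnj t * p \<in> \<real>\<^sub>\<ge>\<^sub>0"
  shows "e = cnj b" and "(cmod b)\<^sup>2 \<le> Re a * Re p"
proof -
  have a: "Im a = 0" "0 \<le> Re a" using H[of 0] by (auto simp: complex_nonneg_Reals_iff)
  have im: "Im (b + e + p) = 0" "Im (- b - e + p) = 0" "Im (-\<i>*b + \<i>*e + p) = 0"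
    using H[of 1] H[of "-1"] H[of \<i>] a by (auto simp: complex_nonneg_Reals_iff)
  then have p: "Im p = 0" by simp
  show e: "e = cnj b" using im p by (auto simp: complex_eq_iff)
  have q: "0 \<le> Re a + 2 * s * (cmod b)\<^sup>2 + s\<^sup>2 * (cmod b)\<^sup>2 * Re p" for s :: real
  proof -
    have "Re (a + cnj (s * b) * b + (s * b) * e + (s * b) * cnj (s * b) * p)
        = Re a + 2 * s * (cmod b)\<^sup>2 + s\<^sup>2 * (cmod b)\<^sup>2 * Re p"
      unfolding e cmod_power2 using p by (simp add: power2_eq_square algebra_simps)
    then show ?thesis using H[of "s * b"] by (simp add: complex_nonneg_Reals_iff)
  qed
  have p0: "0 \<le> Re p"
  proof (rule ccontr)
    assume n: "\<not> 0 \<le> Re p"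
    have s: "0 \<le> Re a + s\<^sup>2 * Re p" for s :: real
      using H[of "of_real s"] H[of "of_real (- s)"] e
      by (simp add: complex_nonneg_Reals_iff power2_eq_square)
    \<comment> \<open>This \<open>s\<close> makes \<open>s\<^sup>2 * Re p\<close> equal to
      \<open>- (Re a + 1)\<close>, one below what is allowed.\<close>
    define s where "s = sqrt ((Re a + 1) / (- Re p))"
    have "0 \<le> (Re a + 1) / (- Re p)" using a n by (intro divide_nonneg_nonneg) auto
    then have "s\<^sup>2 = (Re a + 1) / (- Re p)" unfolding s_def by (rule real_sqrt_pow2)
    then show False using s[of s] n by (simp add: field_simps)
  qed
  show "(cmod b)\<^sup>2 \<le> Re a * Re p"
  proof (cases "Re p = 0")
    case True
    have "(cmod b)\<^sup>2 = 0"
    proof (rule ccontr)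
      assume "(cmod b)\<^sup>2 \<noteq> 0"
      then show False using q[of "- (Re a + 1) / (2 * (cmod b)\<^sup>2)"] True by (simp add: field_simps)
    qed
    then show ?thesis using True by simp
  next
    case False
    then have "0 < Re p" using p0 by simp
    then show ?thesis using q[of "- 1 / Re p"] by (simp add: field_simps power2_eq_square)
  qed
qed

lemma kform_add_scale:
  "kform K F (\<lambda>x. c x + t * d x) (\<lambda>x. c x + t * d x) =
     kform K F c c + cnj t * kform K F c d + t * kform K F d c + t * cnj t * kform K F d d"
  unfolding kform_def sum_distrib_left sum.distrib[symmetric]
  by (intro sum.cong refl) (simp add: algebra_simps)

lemma kform_add_scale_nonneg:
  assumes "pos_kernel X K" "finite F" "F \<subseteq> X"
  shows "kform K F c c + cnj t * kform K F c d + t * kform K F d c + t * cnj t * kform K F d d \<in> \<real>\<^sub>\<ge>\<^sub>0"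
  using pos_kernelD[OF assms, of "\<lambda>x. c x + t * d x"] by (simp only: kform_add_scale)

lemma kform_hermitian:
  assumes "pos_kernel X K" "finite F" "F \<subseteq> X"
  shows "kform K F d c = cnj (kform K F c d)"
  by (rule hermitian_discriminant(1)[OF kform_add_scale_nonneg[OF assms]])

lemma kform_Cauchy_Schwarz:
  assumes "pos_kernel X K" "finite F" "F \<subseteq> X"
  shows "(cmod (kform K F c d))\<^sup>2 \<le> Re (kform K F c c) * Re (kform K F d d)"
  by (rule hermitian_discriminant(2)[OF kform_add_scale_nonneg[OF assms]])

lemma pos_kernel_diag: "pos_kernel X K \<Longrightarrow> x \<in> X \<Longrightarrow> K x x \<in> \<real>\<^sub>\<ge>\<^sub>0"
  using pos_kernelD[of X K "{x}" "\<lambda>_. 1"] by (simp add: kform_def)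

text \<open>With \<open>k x\<close> the kernel function at \<open>x\<close>, this is the norm of the
  vector \<Sum> cnj (c x) k x, equivalently of the functional h \<mapsto> \<Sum> c x * h x.\<close>

definition knorm :: "('a \<Rightarrow> 'a \<Rightarrow> complex) \<Rightarrow> 'a set \<Rightarrow> ('a \<Rightarrow> complex) \<Rightarrow> real" where
  "knorm K F c = sqrt (Re (kform K F c c))"

lemma knorm_nonneg:
  assumes "pos_kernel X K" "finite F" "F \<subseteq> X" shows "0 \<le> knorm K F c"
  using pos_kernelD[OF assms] by (simp add: knorm_def complex_nonneg_Reals_iff)

lemma kform_eq_knorm:
  assumes "pos_kernel X K" "finite F" "F \<subseteq> X"
  shows "kform K F c c = complex_of_real ((knorm K F c)\<^sup>2)"
  using pos_kernelD[OF assms, of c] by (auto simp: knorm_def complex_nonneg_Reals_iff complex_eq_iff)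

lemma cmod_kform_le:
  assumes "pos_kernel X K" "finite F" "F \<subseteq> X"
  shows "cmod (kform K F c d) \<le> knorm K F c * knorm K F d"
  using kform_Cauchy_Schwarz[OF assms, of c d]
  by (simp add: knorm_def real_le_rsqrt flip: real_sqrt_mult)

lemma knorm_add:
  assumes "pos_kernel X K" "finite F" "F \<subseteq> X"
  shows "knorm K F (\<lambda>x. c x + d x) \<le> knorm K F c + knorm K F d"
proof -
  have "kform K F (\<lambda>x. c x + d x) (\<lambda>x. c x + d x) =
     kform K F c c + kform K F c d + cnj (kform K F c d) + kform K F d d"
    using kform_add_scale[of K F c 1 d] kform_hermitian[OF assms, of d c] by simp
  then have "(knorm K F (\<lambda>x. c x + d x))\<^sup>2 = (knorm K F c)\<^sup>2 + 2 * Re (kform K F c d) + (knorm K F d)\<^sup>2"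
    by (simp add: kform_eq_knorm[OF assms] complex_eq_iff)
  also have "\<dots> \<le> (knorm K F c)\<^sup>2 + 2 * (knorm K F c * knorm K F d) + (knorm K F d)\<^sup>2"
    using cmod_kform_le[OF assms, of c d] complex_Re_le_cmod[of "kform K F c d"] by linarith
  also have "\<dots> = (knorm K F c + knorm K F d)\<^sup>2" by (simp add: power2_eq_square algebra_simps)
  finally show ?thesis
    using knorm_nonneg[OF assms] by (meson add_nonneg_nonneg power2_le_imp_le)
qed

lemma knorm_scale: "knorm K F (\<lambda>x. t * c x) = cmod t * knorm K F c"
proof -
  have "kform K F (\<lambda>x. t * c x) (\<lambda>x. t * c x) = (t * cnj t) * kform K F c c"
    by (simp add: kform_def sum_distrib_left algebra_simps)
  also have "\<dots> = complex_of_real ((cmod t)\<^sup>2) * kform K F c c"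
    by (simp only: complex_norm_square)
  finally show ?thesis by (simp add: knorm_def real_sqrt_mult)
qed

lemma kform_mono_neutral:
  assumes "finite F'" "F \<subseteq> F'" "\<And>x. x \<in> F' - F \<Longrightarrow> c x = 0"  "\<And>x. x \<in> F' - F \<Longrightarrow> d x = 0"
  shows "kform K F' c d = kform K F c d"
proof -
  have "kform K F' c d = (\<Sum>x\<in>F. \<Sum>y\<in>F'. c x * cnj (d y) * K x y)"
    unfolding kform_def using assms by (intro sum.mono_neutral_right) auto
  also have "\<dots> = kform K F c d"
    unfolding kform_def using assms by (intro sum.cong refl sum.mono_neutral_right) auto
  finally show ?thesis .
qed

text \<open>The subtracted kernel contributes the square of a modulus, so positivity says that
  \<open>h\<close> induces a functional of norm at most \<open>C\<close> on the span of the kernel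
  functions.\<close>

lemma pos_kernel_dominates_iff:
  assumes "pos_kernel X K" "0 \<le> C"
  shows "pos_kernel X (\<lambda>x y. complex_of_real (C^2) * K x y - h x * cnj (h y)) \<longleftrightarrow>
    (\<forall>F c. finite F \<longrightarrow> F \<subseteq> X \<longrightarrow> cmod (\<Sum>x\<in>F. c x * h x) \<le> C * knorm K F c)"
proof -
  have *: "kform (\<lambda>x y. complex_of_real (C^2) * K x y - h x * cnj (h y)) F c c \<in> \<real>\<^sub>\<ge>\<^sub>0 \<longleftrightarrow>
      cmod (\<Sum>x\<in>F. c x * h x) \<le> C * knorm K F c" if F: "finite F" "F \<subseteq> X" for F c
  proof -
    have "kform (\<lambda>x y. complex_of_real (C^2) * K x y - h x * cnj (h y)) F c c
      = complex_of_real (C^2) * kform K F c c - (\<Sum>x\<in>F. c x * h x) * cnj (\<Sum>x\<in>F. c x * h x)"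
      unfolding cnj_sum sum_product
      by (simp add: kform_def algebra_simps sum_subtractf sum_distrib_left)
    also have "\<dots> = complex_of_real ((C * knorm K F c)\<^sup>2 - (cmod (\<Sum>x\<in>F. c x * h x))\<^sup>2)"
      unfolding kform_eq_knorm[OF assms(1) F] of_real_diff complex_norm_square
      by (simp add: power_mult_distrib)
    finally show ?thesis
      using knorm_nonneg[OF assms(1) F, of c] assms(2)
      by (simp add: abs_le_square_iff[symmetric] del: of_real_diff)
  qed
  then show ?thesis unfolding pos_kernel_iff by blast
qed

text \<open>On coefficients the adjoint of multiplication by \<open>h\<close> acts as c \<mapsto> c
  h; positivity says that its norm is at most \<open>C\<close>.\<close>

lemma pos_kernel_multiplier_iff:
  assumes "pos_kernel X K" "0 \<le> C"
  shows "pos_kernel X (\<lambda>x y. (complex_of_real (C^2) - h x * cnj (h y)) * K x y) \<longleftrightarrow>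
    (\<forall>F c. finite F \<longrightarrow> F \<subseteq> X \<longrightarrow> knorm K F (\<lambda>x. c x * h x) \<le> C * knorm K F c)"
proof -
  have *: "kform (\<lambda>x y. (complex_of_real (C^2) - h x * cnj (h y)) * K x y) F c c \<in> \<real>\<^sub>\<ge>\<^sub>0 \<longleftrightarrow>
      knorm K F (\<lambda>x. c x * h x) \<le> C * knorm K F c" if F: "finite F" "F \<subseteq> X" for F c
  proof -
    have "kform (\<lambda>x y. (complex_of_real (C^2) - h x * cnj (h y)) * K x y) F c c
      = complex_of_real (C^2) * kform K F c c - kform K F (\<lambda>x. c x * h x) (\<lambda>x. c x * h x)"
      by (simp add: kform_def algebra_simps sum_subtractf sum_distrib_left)
    also have "\<dots> = complex_of_real ((C * knorm K F c)\<^sup>2 - (knorm K F (\<lambda>x. c x * h x))\<^sup>2)"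
      unfolding kform_eq_knorm[OF assms(1) F] by (simp add: power_mult_distrib)
    finally show ?thesis
      using knorm_nonneg[OF assms(1) F, of c] knorm_nonneg[OF assms(1) F, of "\<lambda>x. c x * h x"] assms(2)
      by (simp add: abs_le_square_iff[symmetric] del: of_real_diff)
  qed
  then show ?thesis unfolding pos_kernel_iff by blast
qed

text \<open>This is Cauchy-Schwarz against the unit mass at \<open>p\<close>: the column at
  \<open>p\<close> has norm at most the square root of \<open>L p p\<close>.\<close>

lemma pos_kernel_Schur_complement:
  assumes L: "pos_kernel X L" and p: "p \<in> X"
  shows "pos_kernel X (\<lambda>x y. L p p * L x y - L x p * cnj (L y p))"
proof -
  define C where "C = sqrt (Re (L p p))"
  have Lpp: "L p p \<in> \<real>\<^sub>\<ge>\<^sub>0" by (rule pos_kernel_diag[OF L p])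
  have "C\<^sup>2 = Re (L p p)" using Lpp by (simp add: C_def complex_nonneg_Reals_iff)
  then have C2: "complex_of_real (C^2) = L p p"
    using Lpp by (simp add: complex_nonneg_Reals_iff complex_eq_iff)
  have C0: "0 \<le> C" using Lpp by (simp add: C_def complex_nonneg_Reals_iff)
  have "cmod (\<Sum>x\<in>F. c x * L x p) \<le> C * knorm L F c" if F: "finite F" "F \<subseteq> X" for F c
  proof -
    \<comment> \<open>Cutting off is needed because \<open>c\<close> may be nonzero at
      \<open>p\<close> although \<open>p\<close> lies outside \<open>F\<close>.\<close>
    define c' where "c' x = (if x \<in> F then c x else 0)" for x
    define e where "e x = (if x = p then 1 else 0 :: complex)" for x
    let ?F = "insert p F"
    have F': "finite ?F" "?F \<subseteq> X" using F p by auto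
    have "kform L ?F c' e = (\<Sum>x\<in>?F. c' x * L x p)"
    proof -
      have "kform L ?F c' e = (\<Sum>x\<in>?F. \<Sum>y\<in>?F. if y = p then c' x * L x y else 0)"
        unfolding kform_def e_def by (intro sum.cong refl) auto
      also have "\<dots> = (\<Sum>x\<in>?F. c' x * L x p)"
        by (intro sum.cong refl) (simp only: sum.delta F'(1) insertI1 if_True)
      finally show ?thesis .
    qed
    also have "\<dots> = (\<Sum>x\<in>F. c' x * L x p)" using F by (intro sum.mono_neutral_right) (auto simp: c'_def)
    also have "\<dots> = (\<Sum>x\<in>F. c x * L x p)" by (auto simp: c'_def)
    finally have 1: "kform L ?F c' e = (\<Sum>x\<in>F. c x * L x p)" .
    have "kform L ?F c' c' = kform L F c' c'" using F by (intro kform_mono_neutral) (auto simp: c'_def)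
    also have "\<dots> = kform L F c c" unfolding kform_def by (intro sum.cong refl) (auto simp: c'_def)
    finally have 2: "knorm L ?F c' = knorm L F c" by (simp add: knorm_def)
    have "kform L ?F e e = kform L {p} e e" using F by (intro kform_mono_neutral) (auto simp: e_def)
    also have "\<dots> = L p p" by (simp add: kform_def e_def)
    finally have 3: "knorm L ?F e = C" by (simp add: knorm_def C_def)
    show ?thesis using cmod_kform_le[OF L F', of c' e] 1 2 3 by (simp add: mult.commute)
  qed
  then show ?thesis
    using pos_kernel_dominates_iff[OF L C0, of "\<lambda>x. L x p"] C2 by simp
qed

section \<open>Norm-preserving extension by one point\<close>

text \<open>\<open>P c t\<close> plays the role of the norm of \<open>c\<close> plus
  \<open>t\<close> times a new vector. Homogeneity reduces all \<open>t\<close> to 1, 0 and -1, so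
  \<open>W\<close> needs only positive scalings and no linear structure. This allows two uses, for
  the real and then for the imaginary direction of one complex vector.\<close>

lemma Hahn_Banach_step:
  fixes l :: "'w \<Rightarrow> real" and P :: "'w \<Rightarrow> real \<Rightarrow> real" and sc :: "real \<Rightarrow> 'w \<Rightarrow> 'w"
  assumes ne: "W \<noteq> {}"
    and sc: "\<And>s c. 0 < s \<Longrightarrow> c \<in> W \<Longrightarrow> sc s c \<in> W"
    and lsc: "\<And>s c. 0 < s \<Longrightarrow> c \<in> W \<Longrightarrow> l (sc s c) = s * l c"
    and Psc: "\<And>s c t. 0 < s \<Longrightarrow> c \<in> W \<Longrightarrow> P (sc s c) (s * t) = s * P c t"
    and P0: "\<And>c. c \<in> W \<Longrightarrow> l c \<le> P c 0"
    and P1: "\<And>c d. c \<in> W \<Longrightarrow> d \<in> W \<Longrightarrow> l c + l d \<le> P c 1 + P d (-1)"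
  shows "\<exists>a. \<forall>c\<in>W. \<forall>t. l c + t * a \<le> P c t"
proof -
  \<comment> \<open>The largest of the lower bounds coming from -1; the last assumption places it
    below every upper bound coming from 1.\<close>
  define a where "a = (SUP d\<in>W. l d - P d (-1))"
  obtain c0 where c0: "c0 \<in> W" using ne by auto
  have "l d - P d (-1) \<le> P c0 1 - l c0" if "d \<in> W" for d
    using P1[OF c0 that] by linarith
  then have bdd: "bdd_above ((\<lambda>d. l d - P d (-1)) ` W)" by (auto intro!: bdd_aboveI)
  have minus: "l d - a \<le> P d (-1)" if "d \<in> W" for d
    using cSUP_upper[OF that bdd] by (simp add: a_def)
  have plus: "l c + a \<le> P c 1" if "c \<in> W" for c
  proof -
    have "a \<le> P c 1 - l c"
      unfolding a_def by (rule cSUP_least[OF ne]) (use P1[OF that] in force)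
    then show ?thesis by simp
  qed
  have "l c + t * a \<le> P c t" if c: "c \<in> W" for c t
  proof (cases t "0 :: real" rule: linorder_cases)
    case equal then show ?thesis using P0[OF c] by simp
  next
    case greater
    have "(1 / t) * l c + a \<le> (1 / t) * P c t"
      using plus[OF sc[of "1/t", OF _ c]] lsc[of "1/t", OF _ c] Psc[of "1/t" c t, OF _ c] greater by simp
    from mult_left_mono[OF this, of t] show ?thesis using greater by (simp add: distrib_left)
  next
    case less
    have "(- 1 / t) * l c - a \<le> (- 1 / t) * P c t"
      using minus[OF sc[of "- 1/t", OF _ c]] lsc[of "- 1/t", OF _ c] Psc[of "- 1/t" c t, OF _ c] less by simp
    from mult_left_mono[OF this, of "- t"] show ?thesis using less by (simp add: right_diff_distrib)
  qed
  then show ?thesis by blast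
qed

section \<open>Finitely supported coefficients and the extension step\<close>

definition supp :: "('a \<Rightarrow> complex) \<Rightarrow> 'a set" where
  "supp c = {x. c x \<noteq> 0}"

definition fin_supp :: "'a set \<Rightarrow> ('a \<Rightarrow> complex) set" where
  "fin_supp Y = {c. finite (supp c) \<and> supp c \<subseteq> Y}"

lemma fin_supp_add:
  assumes "c \<in> fin_supp Y" "d \<in> fin_supp Y"
  shows "(\<lambda>x. c x + d x) \<in> fin_supp Y"
proof -
  have "supp (\<lambda>x. c x + d x) \<subseteq> supp c \<union> supp d" by (auto simp: supp_def)
  then show ?thesis using assms unfolding fin_supp_def
    by (auto intro: finite_subset)
qed

lemma fin_supp_scale:
  assumes "c \<in> fin_supp Y" shows "(\<lambda>x. t * c x) \<in> fin_supp Y"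
proof -
  have "supp (\<lambda>x. t * c x) \<subseteq> supp c" by (auto simp: supp_def)
  then show ?thesis using assms unfolding fin_supp_def
    by (auto intro: finite_subset)
qed

lemma fin_supp_upd:
  assumes "c \<in> fin_supp M" shows "c(p := t) \<in> fin_supp (insert p M)"
proof -
  have "supp (c(p := t)) \<subseteq> insert p (supp c)" by (auto simp: supp_def)
  then show ?thesis using assms unfolding fin_supp_def
    by (auto intro: finite_subset)
qed

definition fnorm :: "('a \<Rightarrow> 'a \<Rightarrow> complex) \<Rightarrow> ('a \<Rightarrow> complex) \<Rightarrow> real" where
  "fnorm K c = knorm K (supp c) c"

lemma fnorm_eq:
  assumes "finite F" "supp c \<subseteq> F" shows "fnorm K c = knorm K F c"
proof -
  have "kform K F c c = kform K (supp c) c c"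
    by (rule kform_mono_neutral[OF assms]) (simp_all add: supp_def)
  then show ?thesis by (simp only: fnorm_def knorm_def)
qed

definition fsum :: "('a \<Rightarrow> complex) \<Rightarrow> ('a \<Rightarrow> complex) \<Rightarrow> complex" where
  "fsum h c = (\<Sum>x\<in>supp c. c x * h x)"

lemma fsum_eq:
  assumes "finite F" "supp c \<subseteq> F" shows "fsum h c = (\<Sum>x\<in>F. c x * h x)"
  unfolding fsum_def by (rule sum.mono_neutral_left[OF assms]) (simp add: supp_def)

lemma fsum_add:
  assumes "c \<in> fin_supp Y" "d \<in> fin_supp Y"
  shows "fsum h (\<lambda>x. c x + d x) = fsum h c + fsum h d"
proof -
  let ?F = "supp c \<union> supp d"
  have F: "finite ?F" "supp (\<lambda>x. c x + d x) \<subseteq> ?F" using assms by (auto simp: fin_supp_def supp_def)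
  then show ?thesis
    using fsum_eq[of ?F "\<lambda>x. c x + d x" h] fsum_eq[of ?F c h] fsum_eq[of ?F d h]
    by (simp add: sum.distrib algebra_simps)
qed

lemma fsum_scale:
  assumes "c \<in> fin_supp Y" shows "fsum h (\<lambda>x. t * c x) = t * fsum h c"
proof -
  have "supp (\<lambda>x. t * c x) \<subseteq> supp c" by (auto simp: supp_def)
  then show ?thesis
    using assms fsum_eq[of "supp c" "\<lambda>x. t * c x" h]
    by (simp add: fin_supp_def fsum_def sum_distrib_left algebra_simps)
qed

lemma fnorm_add:
  assumes "pos_kernel Y K" "c \<in> fin_supp Y" "d \<in> fin_supp Y"
  shows "fnorm K (\<lambda>x. c x + d x) \<le> fnorm K c + fnorm K d"
proof -
  let ?F = "supp c \<union> supp d"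
  have F: "finite ?F" "?F \<subseteq> Y" "supp (\<lambda>x. c x + d x) \<subseteq> ?F"
    using assms by (auto simp: fin_supp_def supp_def)
  then show ?thesis
    using fnorm_eq[of ?F "\<lambda>x. c x + d x" K] fnorm_eq[of ?F c K] fnorm_eq[of ?F d K]
      knorm_add[OF assms(1) F(1,2), of c d]
    by simp
qed

lemma fnorm_scale:
  assumes "c \<in> fin_supp Y" shows "fnorm K (\<lambda>x. t * c x) = cmod t * fnorm K c"
proof -
  have "supp (\<lambda>x. t * c x) \<subseteq> supp c" by (auto simp: supp_def)
  then have "fnorm K (\<lambda>x. t * c x) = knorm K (supp c) (\<lambda>x. t * c x)"
    using assms by (intro fnorm_eq) (auto simp: fin_supp_def)
  then show ?thesis by (simp add: knorm_scale fnorm_def)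
qed

lemma pos_kernel_dominates_iff_fsum:
  assumes "pos_kernel X K"
  shows "pos_kernel X (\<lambda>x y. K x y - h x * cnj (h y)) \<longleftrightarrow> (\<forall>c\<in>fin_supp X. cmod (fsum h c) \<le> fnorm K c)"
proof -
  have "(\<forall>F c. finite F \<longrightarrow> F \<subseteq> X \<longrightarrow> cmod (\<Sum>x\<in>F. c x * h x) \<le> knorm K F c) \<longleftrightarrow>
    (\<forall>c\<in>fin_supp X. cmod (fsum h c) \<le> fnorm K c)" (is "?L \<longleftrightarrow> ?R")
  proof
    show "?L \<Longrightarrow> ?R" by (auto simp: fin_supp_def fsum_def fnorm_def)
  next
    assume R: ?R
    show ?L
    proof (intro allI impI)
      fix F and c :: "_ \<Rightarrow> complex" assume F: "finite F" "F \<subseteq> X"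
      define d where "d x = (if x \<in> F then c x else 0)" for x
      have s: "supp d \<subseteq> F" by (auto simp: supp_def d_def)
      then have "d \<in> fin_supp X" using F by (auto simp: fin_supp_def intro: finite_subset)
      then have "cmod (fsum h d) \<le> fnorm K d" using R by blast
      moreover have "fsum h d = (\<Sum>x\<in>F. c x * h x)" using fsum_eq[OF F(1) s] by (simp add: d_def)
      moreover have "kform K F d d = kform K F c c" unfolding kform_def by (intro sum.cong refl) (simp add: d_def)
      ultimately show "cmod (\<Sum>x\<in>F. c x * h x) \<le> knorm K F c"
        using fnorm_eq[OF F(1) s, of K] by (simp add: knorm_def)
    qed
  qed
  then show ?thesis using pos_kernel_dominates_iff[OF assms, of 1 h] by simp
qed

text \<open>The function \<open>h\<close> is a functional of norm at most 1 on coefficients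
  supported in \<open>M\<close>. Extending it to the unit mass at \<open>p\<close> without
  increasing the norm gives the missing value. \<open>c(p := t)\<close> is \<open>c\<close> plus
  \<open>t\<close> times that mass, because \<open>c\<close> vanishes at \<open>p\<close>.\<close>

lemma kernel_space_one_point_extension:
  assumes H: "pos_kernel (insert p M) H" and p: "p \<notin> M"
    and h: "pos_kernel M (\<lambda>x y. H x y - h x * cnj (h y))"
  shows "\<exists>v. pos_kernel (insert p M) (\<lambda>x y. H x y - (h(p := v)) x * cnj ((h(p := v)) y))"
proof -
  let ?Y = "insert p M"
  have HM: "pos_kernel M H" using H by (rule pos_kernel_subset) auto
  have h': "cmod (fsum h c) \<le> fnorm H c" if "c \<in> fin_supp M" for c
    using h that pos_kernel_dominates_iff_fsum[OF HM] by blast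
  have Re_h: "Re (fsum h c) \<le> fnorm H c" if "c \<in> fin_supp M" for c
    using h'[OF that] complex_Re_le_cmod[of "fsum h c"] by linarith
  have p0: "c(p := 0) = c" if "c \<in> fin_supp M" for c
    using that p by (auto simp: fin_supp_def supp_def fun_eq_iff)
  have add: "fnorm H ((\<lambda>x. c x + d x)(p := s + t)) \<le> fnorm H (c(p := s)) + fnorm H (d(p := t))"
    if "c \<in> fin_supp M" "d \<in> fin_supp M" for c d s t
  proof -
    have "(\<lambda>x. c x + d x)(p := s + t) = (\<lambda>x. (c(p := s)) x + (d(p := t)) x)" by auto
    then show ?thesis using fnorm_add[OF H fin_supp_upd[OF that(1)] fin_supp_upd[OF that(2)]] by simp
  qed
  have scale: "fnorm H ((\<lambda>x. complex_of_real r * c x)(p := complex_of_real r * s)) = r * fnorm H (c(p := s))"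
    if "c \<in> fin_supp M" "0 < r" for c s r
  proof -
    have "(\<lambda>x. complex_of_real r * c x)(p := complex_of_real r * s) = (\<lambda>x. complex_of_real r * (c(p := s)) x)" by auto
    then show ?thesis using fnorm_scale[OF fin_supp_upd[OF that(1)], of H "complex_of_real r" p s] that by simp
  qed
  have zero: "(\<lambda>_. 0) \<in> fin_supp M" by (simp add: fin_supp_def supp_def)
  have "\<exists>a. \<forall>c\<in>fin_supp M. \<forall>t. Re (fsum h c) + t * a \<le> fnorm H (c(p := complex_of_real t))"
  proof (rule Hahn_Banach_step[where sc = "\<lambda>r c x. complex_of_real r * c x"])
    show "fin_supp M \<noteq> {}" using zero by auto
    show "Re (fsum h c) + Re (fsum h d)
        \<le> fnorm H (c(p := complex_of_real 1)) + fnorm H (d(p := complex_of_real (- 1)))"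
      if cd: "c \<in> fin_supp M" "d \<in> fin_supp M" for c d
      using add[OF cd, of 1 "-1"] Re_h[OF fin_supp_add[OF cd]] fsum_add[OF cd, of h]
        p0[OF fin_supp_add[OF cd]] by simp
  qed (use scale Re_h p0 in \<open>auto simp: fsum_scale[where Y = M] fin_supp_scale\<close>)
  then obtain a where a: "\<And>c t. c \<in> fin_supp M \<Longrightarrow> Re (fsum h c) + t * a \<le> fnorm H (c(p := complex_of_real t))"
    by blast
  have Cm: "Complex s t = complex_of_real s + \<i> * complex_of_real t" for s t by (simp add: Complex_eq)
  \<comment> \<open>The second real extension, along \<i> times the unit mass. The pair
    \<open>(c, s)\<close> stands for \<open>c\<close> plus the real multiple \<open>s\<close> of the
    mass, on which the functional is already fixed by \<open>a\<close>.\<close>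
  have "\<exists>b. \<forall>w\<in>fin_supp M \<times> UNIV. \<forall>t. (Re (fsum h (fst w)) + snd w * a) + t * b
      \<le> fnorm H ((fst w)(p := Complex (snd w) t))"
  proof (rule Hahn_Banach_step[where sc = "\<lambda>r (c, s). (\<lambda>x. complex_of_real r * c x, r * s)"])
    show "fin_supp M \<times> (UNIV :: real set) \<noteq> {}" using zero by auto
    show "(Re (fsum h (fst v)) + snd v * a) + (Re (fsum h (fst w)) + snd w * a)
        \<le> fnorm H ((fst v)(p := Complex (snd v) 1)) + fnorm H ((fst w)(p := Complex (snd w) (- 1)))"
      if vw: "v \<in> fin_supp M \<times> UNIV" "w \<in> fin_supp M \<times> UNIV" for v w
    proof -
      have cd: "fst v \<in> fin_supp M" "fst w \<in> fin_supp M" using vw by auto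
      have "Complex (snd v) 1 + Complex (snd w) (-1) = complex_of_real (snd v + snd w)"
        by (simp add: complex_eq_iff)
      then show ?thesis
        using add[OF cd, of "Complex (snd v) 1" "Complex (snd w) (-1)"] a[OF fin_supp_add[OF cd], of "snd v + snd w"]
          fsum_add[OF cd, of h] by (simp add: algebra_simps)
    qed
    show "Re (fsum h (fst w)) + snd w * a \<le> fnorm H ((fst w)(p := Complex (snd w) 0))"
      if "w \<in> fin_supp M \<times> UNIV" for w
      using a[of "fst w" "snd w"] that by (auto simp: complex_of_real_def)
    show "fnorm H ((fst ((\<lambda>(c, s). (\<lambda>x. complex_of_real r * c x, r * s)) w))
         (p := Complex (snd ((\<lambda>(c, s). (\<lambda>x. complex_of_real r * c x, r * s)) w)) (r * t)))
       = r * fnorm H ((fst w)(p := Complex (snd w) t))"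
      if "0 < r" "w \<in> fin_supp M \<times> UNIV" for r w t
    proof -
      have "Complex (r * snd w) (r * t) = complex_of_real r * Complex (snd w) t" by (simp add: complex_eq_iff)
      then show ?thesis using scale[of "fst w" r] that by (auto simp: split_beta)
    qed
  qed (auto simp: fsum_scale[where Y = M] fin_supp_scale distrib_left)
  then obtain b where b: "\<And>c s t. c \<in> fin_supp M \<Longrightarrow>
      (Re (fsum h c) + s * a) + t * b \<le> fnorm H (c(p := Complex s t))"
    by fastforce
  \<comment> \<open>The sign is the one for which the real part of \<open>(s + \<i> t) * v\<close>
    is \<open>s * a + t * b\<close>.\<close>
  define v where "v = Complex a (- b)"
  define k where "k = h(p := v)"
  have Re_v: "Re (fsum k c) \<le> fnorm H c" if c: "c \<in> fin_supp ?Y" for c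
  proof -
    define d where "d = c(p := 0)"
    have d: "d \<in> fin_supp M" using c unfolding fin_supp_def supp_def d_def
      by (auto intro: finite_subset[of _ "{x. c x \<noteq> 0}"])
    have F: "finite (supp d)" "p \<notin> supp d" "supp c \<subseteq> insert p (supp d)"
      using d by (auto simp: fin_supp_def supp_def d_def)
    have "fsum k c = (\<Sum>x\<in>insert p (supp d). c x * k x)" using F by (intro fsum_eq) auto
    also have "\<dots> = c p * v + (\<Sum>x\<in>supp d. c x * k x)" using F by (simp add: k_def)
    also have "(\<Sum>x\<in>supp d. c x * k x) = fsum h d"
      unfolding fsum_def using F by (intro sum.cong) (auto simp: d_def k_def)
    finally have "Re (fsum k c) = Re (fsum h d) + Re (c p) * a + Im (c p) * b" by (simp add: v_def)
    also have "\<dots> \<le> fnorm H (d(p := Complex (Re (c p)) (Im (c p))))" using b[OF d, of "Re (c p)" "Im (c p)"] by simp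
    also have "d(p := Complex (Re (c p)) (Im (c p))) = c" by (simp add: d_def)
    finally show ?thesis .
  qed
  have "cmod (fsum k c) \<le> fnorm H c" if c: "c \<in> fin_supp ?Y" for c
  proof (cases "fsum k c = 0")
    case True
    have "0 \<le> fnorm H c"
      unfolding fnorm_def using c by (intro knorm_nonneg[OF H]) (auto simp: fin_supp_def)
    then show ?thesis using True by simp
  next
    case False
    \<comment> \<open>A unimodular factor rotates the value to the positive real axis, so the bound
      for real parts becomes a bound for the modulus.\<close>
    define u where "u = cnj (sgn (fsum k c))"
    have u: "cmod u = 1" using False by (simp add: u_def norm_sgn)
    have "u * fsum k c = complex_of_real (cmod (fsum k c))"
      using False complex_norm_square[of "fsum k c"] unfolding u_def sgn_eq
      by (simp add: field_simps power2_eq_square)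
    then have "cmod (fsum k c) = Re (fsum k (\<lambda>x. u * c x))"
      using fsum_scale[OF c, of k u] by simp
    also have "\<dots> \<le> fnorm H (\<lambda>x. u * c x)" by (rule Re_v[OF fin_supp_scale[OF c]])
    also have "\<dots> = fnorm H c" using fnorm_scale[OF c, of H u] u by simp
    finally show ?thesis .
  qed
  then have "pos_kernel ?Y (\<lambda>x y. H x y - k x * cnj (k y))"
    using pos_kernel_dominates_iff_fsum[OF H] by blast
  then show ?thesis unfolding k_def by blast
qed

section \<open>Leech's theorem and Gleason's problem for the Drury-Arveson kernel\<close>

lemma cinner_diff_left: "cinner (x - y) z = cinner x z - cinner y z"
  by (simp add: cinner_def algebra_simps sum_subtractf)

lemma cinner_diff_right: "cinner z (x - y) = cinner z x - cinner z y"
  by (simp add: cinner_def algebra_simps sum_subtractf)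

lemma cinner_zero [simp]: "cinner 0 z = 0" "cinner z 0 = 0"
  by (simp_all add: cinner_def)

lemma cnj_cinner: "cnj (cinner x y) = cinner y x"
  by (simp add: cinner_def mult.commute)

lemma cinner_self: "cinner x x = complex_of_real ((norm x)\<^sup>2)"
  by (simp add: cinner_def complex_norm_square norm_vec_def L2_set_def sum_nonneg flip: of_real_power)

lemma cmod_cinner_le: "cmod (cinner x y) \<le> norm x * norm y"
proof -
  have "cmod (cinner x y) \<le> (\<Sum>i\<in>UNIV. cmod (x $ i) * cmod (y $ i))"
    unfolding cinner_def by (rule order_trans[OF norm_sum]) (simp add: norm_mult)
  also have "\<dots> \<le> norm x * norm y"
    using L2_set_mult_ineq[of "\<lambda>i. cmod (x $ i)" "\<lambda>i. cmod (y $ i)" UNIV] by (simp add: norm_vec_def)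
  finally show ?thesis .
qed

lemma one_minus_cinner_nonzero:
  assumes "norm x < 1" "norm y \<le> 1" shows "1 - cinner x y \<noteq> 0"
proof
  assume "1 - cinner x y = 0"
  then have "cinner x y = 1" by simp
  then have "1 \<le> norm x * norm y" using cmod_cinner_le[of x y] by simp
  also have "\<dots> \<le> norm x * 1" using assms by (intro mult_left_mono) auto
  finally show False using assms by simp
qed

lemma pos_kernel_cinner_mult:
  assumes "pos_kernel X K"
  shows "pos_kernel X (\<lambda>s t. cinner (u s) (u t) * K s t)"
proof -
  have "pos_kernel X (\<lambda>s t. \<Sum>i\<in>UNIV. u s $ i * cnj (u t $ i) * K s t)"
    by (intro pos_kernel_sum pos_kernel_conj assms)
  then show ?thesis by (simp add: cinner_def sum_distrib_right)
qed

lemma pos_kernel_cinner: "pos_kernel X (\<lambda>s t. cinner (u s) (u t))"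
  using pos_kernel_cinner_mult[OF pos_kernel_one] by simp

text \<open>Lagrange's identity turns the Cauchy-Schwarz inequality into a sum of squares.\<close>

lemma pos_kernel_Lagrange:
  assumes K: "pos_kernel X K"
  shows "pos_kernel X (\<lambda>s t. (cinner b b * cinner (u s) (u t) - cinner (u s) b * cinner b (u t)) * K s t)"
proof -
  \<comment> \<open>The 2 x 2 minors of \<open>u s\<close> and \<open>b\<close>. The double sum
    counts each pair of indices twice, hence the factor 1/2 below.\<close>
  define m where "m i j s = u s $ i * b $ j - u s $ j * b $ i" for i j s
  have eq: "cinner b b * cinner (u s) (u t) - cinner (u s) b * cinner b (u t)
      = complex_of_real (1/2) * (\<Sum>i\<in>UNIV. \<Sum>j\<in>UNIV. m i j s * cnj (m i j t))" for s t
  proof -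
    let ?A = "\<lambda>i j. u s $ i * cnj (u t $ i) * (b $ j * cnj (b $ j))"
    let ?B = "\<lambda>i j. u s $ i * cnj (b $ i) * (b $ j * cnj (u t $ j))"
    have "(\<Sum>i\<in>UNIV. \<Sum>j\<in>UNIV. m i j s * cnj (m i j t))
        = (\<Sum>i\<in>UNIV. \<Sum>j\<in>UNIV. (?A i j - ?B i j) + (?A j i - ?B j i))"
      by (intro sum.cong refl) (simp add: m_def algebra_simps)
    also have "\<dots> = (\<Sum>i\<in>UNIV. \<Sum>j\<in>UNIV. ?A i j - ?B i j) + (\<Sum>i\<in>UNIV. \<Sum>j\<in>UNIV. ?A j i - ?B j i)"
      by (simp only: sum.distrib)
    also have "(\<Sum>i\<in>UNIV. \<Sum>j\<in>UNIV. ?A j i - ?B j i) = (\<Sum>i\<in>UNIV. \<Sum>j\<in>UNIV. ?A i j - ?B i j)"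
      by (rule sum.swap)
    also have "(\<Sum>i\<in>UNIV. \<Sum>j\<in>UNIV. ?A i j - ?B i j)
        = cinner (u s) (u t) * cinner b b - cinner (u s) b * cinner b (u t)"
      unfolding cinner_def sum_product by (simp only: sum_subtractf)
    finally show ?thesis by (simp add: algebra_simps)
  qed
  have "pos_kernel X (\<lambda>s t. complex_of_real (1/2) * (\<Sum>i\<in>UNIV. \<Sum>j\<in>UNIV. m i j s * cnj (m i j t) * K s t))"
    by (intro pos_kernel_scale pos_kernel_sum pos_kernel_conj K) simp
  then show ?thesis unfolding eq by (simp add: sum_distrib_right)
qed

text \<open>The kernel is the geometric series in the Gram kernel, whose powers are positive by
  repeated Schur products.\<close>

lemma pos_kernel_DA:
  fixes F :: "'a \<Rightarrow> complex ^ 'n"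
  assumes F: "\<And>x. x \<in> X \<Longrightarrow> norm (F x) < 1"
  shows "pos_kernel X (\<lambda>x y. DA_kernel (F x) (F y))"
proof -
  have pw: "pos_kernel X (\<lambda>x y. cinner (F x) (F y) ^ n)" for n
  proof (induction n)
    case 0 then show ?case by (simp add: pos_kernel_one)
  next
    case (Suc n) then show ?case using pos_kernel_cinner_mult[OF Suc, of F] by simp
  qed
  show ?thesis
  proof (rule pos_kernel_limit)
    show "pos_kernel X (\<lambda>x y. \<Sum>n<N. cinner (F x) (F y) ^ n)" for N
      by (intro pos_kernel_sum pw)
    show "(\<lambda>N. \<Sum>n<N. cinner (F x) (F y) ^ n) \<longlonglongrightarrow> DA_kernel (F x) (F y)" if "x \<in> X" "y \<in> X" for x y
    proof -
      have "norm (F x) * norm (F y) < 1 * 1" using F[OF that(1)] F[OF that(2)]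
        by (intro mult_strict_mono') auto
      then have "cmod (cinner (F x) (F y)) < 1" using cmod_cinner_le[of "F x" "F y"] by simp
      then show ?thesis
        using geometric_sums unfolding sums_def DA_kernel_def by blast
    qed
  qed
qed

section \<open>The one-point Pick extension\<close>

text \<open>The Pick form is known to be positive only over the old points, while the kernel
  dominating the extension has to live on the new point as well.\<close>

lemma pos_kernel_extend_zero:
  assumes "pos_kernel M P"
  shows "pos_kernel Y (\<lambda>s t. if s \<in> M \<and> t \<in> M then P s t else 0)" (is "pos_kernel Y ?Q")
proof (rule pos_kernelI)
  fix F and c :: "'a \<Rightarrow> complex" assume F: "finite F" "F \<subseteq> Y"
  have "kform ?Q F c c = (\<Sum>x\<in>F \<inter> M. \<Sum>y\<in>F. c x * cnj (c y) * ?Q x y)"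
    unfolding kform_def using F by (intro sum.mono_neutral_right) auto
  also have "\<dots> = (\<Sum>x\<in>F \<inter> M. \<Sum>y\<in>F \<inter> M. c x * cnj (c y) * ?Q x y)"
    using F by (intro sum.cong[OF refl] sum.mono_neutral_right) auto
  also have "\<dots> = kform P (F \<inter> M) c c"
    unfolding kform_def by (intro sum.cong refl) auto
  finally show "kform ?Q F c c \<in> \<real>\<^sub>\<ge>\<^sub>0" using pos_kernelD[OF assms, of "F \<inter> M" c] F by auto
qed

text \<open>With \<open>b = z p\<close> and \<open>g s = 1 - \<langle>z s, b\<rangle>\<close>, the identity \<open>g s (g t)\<^sup>* - (1 - |b|\<^sup>2)(1 - \<langle>z s, z t\<rangle>) = N s t\<close>
  with \<open>N\<close> positive and \<open>N p t = 0\<close> is the complete Pick property: dividing the Pick form by the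
  column at \<open>p\<close> makes the unknown value enter only through a one-point norm-preserving extension.\<close>

lemma complete_Pick_one_step:
  fixes z :: "'l \<Rightarrow> complex ^ 'n" and e :: "'l \<Rightarrow> complex ^ 'm" and \<eta> :: "'l \<Rightarrow> complex"
  assumes z: "\<And>s. s \<in> insert p M \<Longrightarrow> norm (z s) < 1" and p: "p \<notin> M"
    and P: "pos_kernel M (\<lambda>s t. (cinner (e s) (e t) - \<eta> s * cnj (\<eta> t)) * DA_kernel (z s) (z t))"
  shows "\<exists>v. pos_kernel (insert p M)
    (\<lambda>s t. (cinner (e s) (e t) - (\<eta>(p := v)) s * cnj ((\<eta>(p := v)) t)) * DA_kernel (z s) (z t))"
proof -
  define b where "b = z p"
  define r where "r = 1 - (norm b)\<^sup>2"
  define g where "g s = 1 - cinner (z s) b" for s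
  define N where "N s t = complex_of_real r * cinner (z s - b) (z t - b) + cinner (z s - b) b * cinner b (z t - b)" for s t
  define P0 where "P0 s t = (cinner (e s) (e t) - \<eta> s * cnj (\<eta> t)) * DA_kernel (z s) (z t)" for s t
  define Q where "Q s t = (if s \<in> M \<and> t \<in> M then P0 s t else 0)" for s t
  \<comment> \<open>Over \<open>M\<close> the kernel times \<open>1 - cinner (z s) (z t)\<close> is
    1, so the identity for \<open>N\<close> turns \<open>H s t - \<eta> s * cnj (\<eta> t)\<close>
    into \<open>g s * cnj (g t) * P0 s t / r\<close>, which is positive. When \<open>s\<close> or
    \<open>t\<close> is \<open>p\<close> the second summand vanishes, so \<open>H\<close> does not
    involve the unknown value.\<close>
  define H where "H s t = cinner (e s) (e t) + complex_of_real (1 / r) * (N s t * Q s t)" for s t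
  have b: "norm b < 1" using z[of p] by (simp add: b_def)
  then have r: "0 < r" unfolding r_def by (simp add: power_less_one_iff abs_square_less_1)
  have bb: "cinner b b = 1 - complex_of_real r" by (simp add: cinner_self r_def)
  have g0: "g s \<noteq> 0" if "s \<in> insert p M" for s
    unfolding g_def using one_minus_cinner_nonzero[OF z[OF that], of b] b by simp
  have D0: "1 - cinner (z s) (z t) \<noteq> 0" if "s \<in> insert p M" "t \<in> insert p M" for s t
    using one_minus_cinner_nonzero[OF z[OF that(1)], of "z t"] z[OF that(2)] by simp
  have cg: "cnj (g t) = 1 - cinner b (z t)" for t by (simp add: g_def cnj_cinner)
  have N: "N s t = g s * cnj (g t) - complex_of_real r * (1 - cinner (z s) (z t))" for s t
    unfolding N_def cg g_def cinner_diff_left cinner_diff_right bb by (simp add: cnj_cinner algebra_simps)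
  have Q: "pos_kernel Y Q" for Y
    unfolding Q_def using P by (intro pos_kernel_extend_zero) (simp add: P0_def)
  have NQ: "pos_kernel Y (\<lambda>s t. N s t * Q s t)" for Y
  proof -
    have "pos_kernel Y (\<lambda>s t. complex_of_real r * (cinner (z s - b) (z t - b) * Q s t)
        + cinner (z s - b) b * cnj (cinner (z t - b) b) * Q s t)"
      using r by (intro pos_kernel_add pos_kernel_scale pos_kernel_cinner_mult pos_kernel_conj Q) simp
    then show ?thesis by (simp add: N_def cnj_cinner algebra_simps)
  qed
  have H: "pos_kernel (insert p M) H"
    unfolding H_def using r by (intro pos_kernel_add pos_kernel_cinner pos_kernel_scale NQ) simp
  have "pos_kernel M (\<lambda>s t. H s t - \<eta> s * cnj (\<eta> t)) \<longleftrightarrow>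
    pos_kernel M (\<lambda>s t. complex_of_real (1 / r) * (g s * cnj (g t) * P0 s t))"
  proof (rule pos_kernel_cong)
    fix s t assume st: "s \<in> M" "t \<in> M"
    have "1 - cinner (z s) (z t) \<noteq> 0" using D0 st by auto
    then show "H s t - \<eta> s * cnj (\<eta> t) = complex_of_real (1 / r) * (g s * cnj (g t) * P0 s t)"
      unfolding H_def Q_def N P0_def DA_kernel_def using st r by (simp add: field_simps)
  qed
  moreover have "pos_kernel M (\<lambda>s t. complex_of_real (1 / r) * (g s * cnj (g t) * P0 s t))"
    using P r unfolding P0_def by (intro pos_kernel_scale pos_kernel_conj) auto
  ultimately obtain v where v: "pos_kernel (insert p M) (\<lambda>s t. H s t - (\<eta>(p := v)) s * cnj ((\<eta>(p := v)) t))"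
    using kernel_space_one_point_extension[OF H p] by blast
  define k where "k = \<eta>(p := v)"
  \<comment> \<open>Undoing the conjugation by \<open>g\<close> and the factor \<open>1 / r\<close>
    must return the Pick form on the old points and, at the new one, the Pick form with value
    \<open>v\<close>.\<close>
  have "pos_kernel (insert p M) (\<lambda>s t. complex_of_real r * (inverse (g s) * cnj (inverse (g t)) * (H s t - k s * cnj (k t))))"
    using v r unfolding k_def by (intro pos_kernel_scale pos_kernel_conj) auto
  moreover have "complex_of_real r * (inverse (g s) * cnj (inverse (g t)) * (H s t - k s * cnj (k t)))
      = (cinner (e s) (e t) - k s * cnj (k t)) * DA_kernel (z s) (z t)"
    if st: "s \<in> insert p M" "t \<in> insert p M" for s t
  proof -
    have nz: "g s \<noteq> 0" "cnj (g t) \<noteq> 0" "1 - cinner (z s) (z t) \<noteq> 0" using g0 D0 st by auto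
    show ?thesis
    proof (cases "s \<in> M \<and> t \<in> M")
      case True
      then have "k s = \<eta> s" "k t = \<eta> t" using p by (auto simp: k_def)
      then show ?thesis using True nz r
        unfolding H_def Q_def N P0_def DA_kernel_def by (simp add: field_simps)
    next
      \<comment> \<open>One of the two points is \<open>p\<close>. There \<open>N\<close> vanishes,
        so its identity gives the kernel as a product of a function of \<open>s\<close> and a
        function of \<open>t\<close>.\<close>
      case False
      then have "N s t = 0" using st by (auto simp: N_def b_def)
      moreover from this have "DA_kernel (z s) (z t) = complex_of_real r / (g s * cnj (g t))"
        using nz by (simp add: N DA_kernel_def field_simps)
      ultimately show ?thesis by (simp add: H_def field_simps)
    qed
  qed
  ultimately have "pos_kernel (insert p M) (\<lambda>s t. (cinner (e s) (e t) - k s * cnj (k t)) * DA_kernel (z s) (z t))"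
    by (rule pos_kernel_eqI)
  then show ?thesis unfolding k_def by blast
qed

section \<open>Leech's theorem by maximal positive families of tangential data\<close>

lemma pos_kernel_Union_chain:
  assumes "subset.chain A C" "C \<noteq> {}" "\<And>M. M \<in> C \<Longrightarrow> pos_kernel M K"
  shows "pos_kernel (\<Union>C) K"
proof (rule pos_kernelI)
  fix F c assume F: "finite F" "F \<subseteq> \<Union>C"
  obtain M where "M \<in> C" "F \<subseteq> M" using finite_subset_Union_chain[OF F assms(2,1)] by blast
  then show "kform K F c c \<in> \<real>\<^sub>\<ge>\<^sub>0" using pos_kernelD[OF assms(3)] F by blast
qed

text \<open>A triple \<open>(x, e, \<eta>)\<close> below prescribes the tangential value \<open>(\<Sum>i. e $ i * \<psi> i x) = \<eta>\<close>; linearity in \<open>e\<close> need not be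
  imposed because it follows from positivity.\<close>

lemma DA_Leech:
  fixes F :: "'x \<Rightarrow> complex ^ 'n" and a :: "'x \<Rightarrow> complex ^ 'm" and \<phi> :: "'x \<Rightarrow> complex"
  assumes F: "\<And>x. x \<in> X \<Longrightarrow> norm (F x) < 1"
    and pos: "pos_kernel X (\<lambda>x y. (cinner (a x) (a y) - \<phi> x * cnj (\<phi> y)) * DA_kernel (F x) (F y))"
  shows "\<exists>\<psi>. (\<forall>x\<in>X. \<phi> x = (\<Sum>i\<in>UNIV. a x $ i * \<psi> i x)) \<and>
    (\<forall>i. pos_kernel X (\<lambda>x y. (1 - \<psi> i x * cnj (\<psi> i y)) * DA_kernel (F x) (F y)))"
proof -
  define P :: "'x \<times> (complex ^ 'm) \<times> complex \<Rightarrow> 'x \<times> (complex ^ 'm) \<times> complex \<Rightarrow> complex" where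
    "P s t = (cinner (fst (snd s)) (fst (snd t)) - snd (snd s) * cnj (snd (snd t))) * DA_kernel (F (fst s)) (F (fst t))" for s t
  define M0 where "M0 = (\<lambda>x. (x, a x, \<phi> x)) ` X"
  define \<A> where "\<A> = {M. M0 \<subseteq> M \<and> fst ` M \<subseteq> X \<and> pos_kernel M P}"
  have "pos_kernel M0 (\<lambda>s t. (\<lambda>x y. (cinner (a x) (a y) - \<phi> x * cnj (\<phi> y)) * DA_kernel (F x) (F y)) (fst s) (fst t))"
    by (rule pos_kernel_pullback[OF pos]) (auto simp: M0_def)
  then have "pos_kernel M0 P"
    by (rule pos_kernel_eqI) (auto simp: M0_def P_def)
  then have "M0 \<in> \<A>" by (auto simp: \<A>_def M0_def)
  moreover have "\<Union>C \<in> \<A>" if C: "C \<noteq> {}" "subset.chain \<A> C" for C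
  proof -
    have CA: "C \<subseteq> \<A>" using C by (simp add: subset.chain_def)
    have "pos_kernel (\<Union>C) P" by (rule pos_kernel_Union_chain[OF C(2,1)]) (use CA in \<open>auto simp: \<A>_def\<close>)
    then show ?thesis using C(1) CA unfolding \<A>_def by blast
  qed
  ultimately obtain M where M: "M \<in> \<A>" and max: "\<And>M'. M' \<in> \<A> \<Longrightarrow> M \<subseteq> M' \<Longrightarrow> M' = M"
    using subset_Zorn_nonempty[of \<A>] by blast
  have MP: "pos_kernel M P" and MX: "fst ` M \<subseteq> X" and M0: "M0 \<subseteq> M" using M by (auto simp: \<A>_def)
  have total: "\<exists>v. (x, e, v) \<in> M" if x: "x \<in> X" for x e
  proof -
    \<comment> \<open>The index \<open>None\<close> carries the new datum while its value is still
      unknown. It is distinct from every old index, even when the triple finally obtained already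
      belongs to \<open>M\<close>.\<close>
    define Z where "Z l = F (case l of None \<Rightarrow> x | Some s \<Rightarrow> fst s)" for l :: "('x \<times> (complex ^ 'm) \<times> complex) option"
    define E where "E l = (case l of None \<Rightarrow> e | Some s \<Rightarrow> fst (snd s))" for l :: "('x \<times> (complex ^ 'm) \<times> complex) option"
    define \<eta> where "\<eta> l = (case l of None \<Rightarrow> 0 | Some s \<Rightarrow> snd (snd s))" for l :: "('x \<times> (complex ^ 'm) \<times> complex) option"
    have "pos_kernel (Some ` M) (\<lambda>s t. P (the s) (the t))"
      by (rule pos_kernel_pullback[OF MP]) auto
    then have "pos_kernel (Some ` M) (\<lambda>s t. (cinner (E s) (E t) - \<eta> s * cnj (\<eta> t)) * DA_kernel (Z s) (Z t))"
      by (rule pos_kernel_eqI) (auto simp: P_def E_def \<eta>_def Z_def)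
    moreover have "norm (Z s) < 1" if "s \<in> insert None (Some ` M)" for s
      using that x F MX by (auto simp: Z_def)
    ultimately obtain v where v: "pos_kernel (insert None (Some ` M))
        (\<lambda>s t. (cinner (E s) (E t) - (\<eta>(None := v)) s * cnj ((\<eta>(None := v)) t)) * DA_kernel (Z s) (Z t))"
      using complete_Pick_one_step[of None "Some ` M" Z E \<eta>] by auto
    let ?M = "insert (x, e, v) M"
    define m where "m s = (if s \<in> M then Some s else None)" for s
    have "pos_kernel ?M P"
      by (rule pos_kernel_eqI[OF pos_kernel_pullback[OF v, of m]])
        (auto simp: m_def P_def E_def \<eta>_def Z_def)
    then have "?M \<in> \<A>" using x MX M0 by (auto simp: \<A>_def)
    then show ?thesis using max[of ?M] by auto
  qed
  define \<psi> where "\<psi> i x = (SOME v. (x, axis i 1, v) \<in> M)" for i x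
  have \<psi>: "(x, axis i 1, \<psi> i x) \<in> M" if "x \<in> X" for i x
    unfolding \<psi>_def by (rule someI_ex[OF total[OF that]])
  \<comment> \<open>Restricted to the data in direction \<open>axis i 1\<close>, a unit vector, the
    Pick form is exactly the condition that \<open>\<psi> i\<close> be a contractive
    multiplier.\<close>
  have "pos_kernel X (\<lambda>x y. (1 - \<psi> i x * cnj (\<psi> i y)) * DA_kernel (F x) (F y))" for i
  proof -
    have "cinner (axis i 1) (axis i 1 :: complex ^ 'm) = 1"
    proof -
      have "cinner (axis i 1) (axis i 1 :: complex ^ 'm) = (\<Sum>j\<in>UNIV. if j = i then 1 else 0)"
        unfolding cinner_def by (intro sum.cong) (auto simp: axis_def)
      then show ?thesis by simp
    qed
    then show ?thesis
      using pos_kernel_pullback[OF MP, of "\<lambda>x. (x, axis i 1, \<psi> i x)" X] \<psi> by (auto simp: P_def)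
  qed
  moreover have "\<phi> x = (\<Sum>i\<in>UNIV. a x $ i * \<psi> i x)" if x: "x \<in> X" for x
  proof -
    define s where "s j = (case j of None \<Rightarrow> (x, a x, \<phi> x) | Some i \<Rightarrow> (x, axis i 1, \<psi> i x))" for j
    \<comment> \<open>The combination of the coordinate data minus the original datum has total
      direction 0. Since all these data sit over \<open>x\<close>, the form evaluates to minus the
      squared modulus of the total value times a positive number; positivity forces that value to be
      0.\<close>
    define c where "c j = (case j of None \<Rightarrow> - 1 | Some i \<Rightarrow> a x $ i)" for j
    define D where "D = DA_kernel (F x) (F x)"
    let ?d = "\<Sum>j\<in>UNIV. c j * snd (snd (s j))"
    have sM: "s j \<in> M" for j using M0 \<psi>[OF x] x by (auto simp: s_def M0_def split: option.split)
    have split: "(\<Sum>j\<in>UNIV. f j) = f None + (\<Sum>i\<in>UNIV. f (Some i))" for f :: "'m option \<Rightarrow> complex"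
      by (simp add: UNIV_option_conv sum.reindex)
    have e0: "(\<Sum>j\<in>UNIV. c j * fst (snd (s j)) $ k) = 0" for k
    proof -
      have "(\<Sum>i\<in>UNIV. a x $ i * (axis i 1 :: complex ^ 'm) $ k) = a x $ k"
        by (simp add: axis_def if_distrib[of "\<lambda>u. a x $ _ * u"] cong: if_cong)
      then show ?thesis by (simp add: split c_def s_def)
    qed
    have fs: "fst (s j) = x" for j by (simp add: s_def split: option.split)
    have "pos_kernel UNIV (\<lambda>i j. P (s i) (s j))"
      by (rule pos_kernel_pullback[OF MP]) (use sM in auto)
    then have "kform (\<lambda>i j. P (s i) (s j)) UNIV c c \<in> \<real>\<^sub>\<ge>\<^sub>0" by (rule pos_kernelD) auto
    also have "kform (\<lambda>i j. P (s i) (s j)) UNIV c c =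
       ((\<Sum>k\<in>UNIV. (\<Sum>j\<in>UNIV. c j * fst (snd (s j)) $ k) * cnj (\<Sum>j\<in>UNIV. c j * fst (snd (s j)) $ k)) - ?d * cnj ?d) * D"
    proof -
      have "kform (\<lambda>i j. P (s i) (s j)) UNIV c c =
        ((\<Sum>i\<in>UNIV. \<Sum>j\<in>UNIV. \<Sum>k\<in>UNIV. (c i * fst (snd (s i)) $ k) * cnj (c j * fst (snd (s j)) $ k))
         - (\<Sum>i\<in>UNIV. \<Sum>j\<in>UNIV. (c i * snd (snd (s i))) * cnj (c j * snd (snd (s j))))) * D"
        unfolding kform_def P_def cinner_def fs D_def[symmetric]
        by (simp add: sum_distrib_left sum_distrib_right sum_subtractf algebra_simps)
      also have "(\<Sum>i\<in>UNIV. \<Sum>j\<in>UNIV. \<Sum>k\<in>UNIV. (c i * fst (snd (s i)) $ k) * cnj (c j * fst (snd (s j)) $ k))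
        = (\<Sum>k\<in>UNIV. \<Sum>i\<in>UNIV. \<Sum>j\<in>UNIV. (c i * fst (snd (s i)) $ k) * cnj (c j * fst (snd (s j)) $ k))"
        by (subst sum.swap, subst (2) sum.swap) (rule refl)
      finally show ?thesis unfolding cnj_sum sum_product .
    qed
    also have "\<dots> = - complex_of_real ((cmod ?d)\<^sup>2) * D" unfolding complex_norm_square e0 by simp
    also have "\<dots> = complex_of_real (- ((cmod ?d)\<^sup>2 / (1 - (norm (F x))\<^sup>2)))"
      by (simp add: D_def DA_kernel_def cinner_self)
    finally have "(cmod ?d)\<^sup>2 / (1 - (norm (F x))\<^sup>2) \<le> 0" by (simp add: complex_nonneg_Reals_iff)
    moreover have "0 < 1 - (norm (F x))\<^sup>2" using F[OF x] by (simp add: abs_square_less_1)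
    ultimately have "?d = 0" by (simp add: divide_le_0_iff)
    then show ?thesis by (simp add: split c_def s_def)
  qed
  ultimately show ?thesis by blast
qed

text \<open>The factor \<open>1 - \<langle>F x, F p\<rangle>\<close> saves composing with a ball automorphism.\<close>

lemma DA_Gleason:
  fixes F :: "'x \<Rightarrow> complex ^ 'n" and \<phi> :: "'x \<Rightarrow> complex"
  assumes F: "\<And>x. x \<in> X \<Longrightarrow> norm (F x) < 1" and p: "p \<in> X" and p0: "\<phi> p = 0"
    and \<phi>: "pos_kernel X (\<lambda>x y. (1 - \<phi> x * cnj (\<phi> y)) * DA_kernel (F x) (F y))"
  shows "\<exists>\<psi>. (\<forall>x\<in>X. (1 - cinner (F x) (F p)) * \<phi> x = (\<Sum>i\<in>UNIV. (F x - F p) $ i * \<psi> i x)) \<and>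
    (\<forall>i. pos_kernel X (\<lambda>x y. (1 - \<psi> i x * cnj (\<psi> i y)) * DA_kernel (F x) (F y)))"
proof (rule DA_Leech[OF F])
  let ?K = "\<lambda>x y. DA_kernel (F x) (F y)"
  define b where "b = F p"
  define r where "r = 1 - (norm b)\<^sup>2"
  define g where "g x = 1 - cinner (F x) b" for x
  define L where "L x y = (1 - \<phi> x * cnj (\<phi> y)) * ?K x y" for x y
  have b: "norm b < 1" using F[OF p] by (simp add: b_def)
  then have r: "0 < r" unfolding r_def by (simp add: abs_square_less_1)
  have bb: "cinner b b = 1 - complex_of_real r" by (simp add: cinner_self r_def)
  have g0: "g x \<noteq> 0" if "x \<in> X" for x
    unfolding g_def using one_minus_cinner_nonzero[OF F[OF that], of b] b by simp
  have D0: "1 - cinner (F x) (F y) \<noteq> 0" if "x \<in> X" "y \<in> X" for x y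
    using one_minus_cinner_nonzero[OF F[OF that(1)], of "F y"] F[OF that(2)] by simp
  have cg: "cnj (g y) = 1 - cinner b (F y)" for y by (simp add: g_def cnj_cinner)
  \<comment> \<open>Because \<open>\<phi> p = 0\<close>, the column of \<open>L\<close> at
    \<open>p\<close> is that of the Drury-Arveson kernel. The Schur complement of \<open>L\<close>
    at \<open>p\<close>, rescaled, therefore becomes
    \<open>g x * cnj (g y) * L x y - r\<close>.\<close>
  have Lxp: "L x p = 1 / g x" for x by (simp add: L_def p0 DA_kernel_def g_def b_def)
  have Lpp: "L p p = 1 / complex_of_real r" by (simp add: Lxp g_def bb flip: b_def)
  have "pos_kernel X L" using \<phi> unfolding L_def .
  from pos_kernel_Schur_complement[OF this p]
  have "pos_kernel X (\<lambda>x y. complex_of_real r * (g x * cnj (g y) * (L p p * L x y - L x p * cnj (L y p))))"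
    using r by (intro pos_kernel_scale pos_kernel_conj) auto
  moreover have "complex_of_real r * (g x * cnj (g y) * (L p p * L x y - L x p * cnj (L y p)))
     = g x * cnj (g y) * L x y - complex_of_real r" if "x \<in> X" "y \<in> X" for x y
    unfolding Lxp[of x] Lxp[of y] Lpp using g0[OF that(1)] g0[OF that(2)] r by (simp add: field_simps)
  ultimately have "pos_kernel X (\<lambda>x y. g x * cnj (g y) * L x y - complex_of_real r)"
    by (rule pos_kernel_eqI)
  \<comment> \<open>The product \<open>g x * cnj (g y)\<close> minus
    \<open>r * (1 - cinner (F x) (F y))\<close> is \<open>r\<close> times the inner product of
    \<open>F x - b\<close> and \<open>F y - b\<close> plus
    \<open>cinner (F x - b) b * cinner b (F y - b)\<close>. As \<open>r\<close> and
    \<open>cinner b b\<close> add up to 1, Lagrange's kernel completes this to that inner product,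
    the Gram kernel needed for Leech's theorem.\<close>
  moreover have "pos_kernel X (\<lambda>x y. (cinner b b * cinner (F x - b) (F y - b) - cinner (F x - b) b * cinner b (F y - b)) * ?K x y)"
    by (intro pos_kernel_Lagrange pos_kernel_DA F)
  ultimately have "pos_kernel X (\<lambda>x y. (g x * cnj (g y) * L x y - complex_of_real r) +
     (cinner b b * cinner (F x - b) (F y - b) - cinner (F x - b) b * cinner b (F y - b)) * ?K x y)"
    by (rule pos_kernel_add)
  then have "pos_kernel X (\<lambda>x y. (cinner (F x - b) (F y - b) - (g x * \<phi> x) * cnj (g y * \<phi> y)) * ?K x y)"
  proof (rule pos_kernel_eqI)
    fix x y assume "x \<in> X" "y \<in> X"
    then have K: "complex_of_real r = complex_of_real r * (1 - cinner (F x) (F y)) * ?K x y"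
      using D0 by (simp add: DA_kernel_def)
    have "(g x * cnj (g y) * L x y - complex_of_real r) +
     (cinner b b * cinner (F x - b) (F y - b) - cinner (F x - b) b * cinner b (F y - b)) * ?K x y
     = (g x * cnj (g y) * (1 - \<phi> x * cnj (\<phi> y)) - complex_of_real r * (1 - cinner (F x) (F y)) +
        (cinner b b * cinner (F x - b) (F y - b) - cinner (F x - b) b * cinner b (F y - b))) * ?K x y"
      unfolding L_def by (subst K) (simp only: algebra_simps)
    also have "g x * cnj (g y) * (1 - \<phi> x * cnj (\<phi> y)) - complex_of_real r * (1 - cinner (F x) (F y)) +
        (cinner b b * cinner (F x - b) (F y - b) - cinner (F x - b) b * cinner b (F y - b))
      = cinner (F x - b) (F y - b) - (g x * \<phi> x) * cnj (g y * \<phi> y)"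
      unfolding complex_cnj_mult cg g_def cinner_diff_left cinner_diff_right bb by (simp add: cnj_cinner algebra_simps)
    finally show "(g x * cnj (g y) * L x y - complex_of_real r) +
     (cinner b b * cinner (F x - b) (F y - b) - cinner (F x - b) b * cinner b (F y - b)) * ?K x y
     = (cinner (F x - b) (F y - b) - (g x * \<phi> x) * cnj (g y * \<phi> y)) * ?K x y" .
  qed
  then show "pos_kernel X (\<lambda>x y. (cinner (F x - F p) (F y - F p) -
    ((1 - cinner (F x) (F p)) * \<phi> x) * cnj ((1 - cinner (F y) (F p)) * \<phi> y)) * DA_kernel (F x) (F y))"
    unfolding g_def b_def .
qed

section \<open>Multiplier norms and the closed graph theorem\<close>

text \<open>The closed balls of a normed space of functions, described by their radii alone. It
  covers the balls of a kernel space and of its multiplier algebra, and also the functions whose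
  product with a fixed \<open>\<phi>\<close> lies in a given ball.\<close>

locale ball_family =
  fixes A :: "real \<Rightarrow> ('a \<Rightarrow> complex) set"
  assumes mono: "0 \<le> r \<Longrightarrow> r \<le> s \<Longrightarrow> A r \<subseteq> A s"
    and zero: "(\<lambda>_. 0) \<in> A 0"
    and add: "0 \<le> r \<Longrightarrow> 0 \<le> s \<Longrightarrow> h \<in> A r \<Longrightarrow> k \<in> A s \<Longrightarrow> (\<lambda>x. h x + k x) \<in> A (r + s)"
    and scale: "0 \<le> r \<Longrightarrow> h \<in> A r \<Longrightarrow> (\<lambda>x. c * h x) \<in> A (cmod c * r)"
    and closed: "0 \<le> r \<Longrightarrow> (\<And>n. H n \<in> A r) \<Longrightarrow> (\<And>x. (\<lambda>n. H n x) \<longlonglongrightarrow> l x) \<Longrightarrow> l \<in> A r"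

text \<open>A gliding hump argument, in which closedness of the balls under pointwise limits plays the role of completeness.\<close>

lemma ball_family_closed_graph:
  assumes "ball_family A" "ball_family B"
    and bound: "\<And>r h x. 0 \<le> r \<Longrightarrow> h \<in> A r \<Longrightarrow> cmod (h x) \<le> r * k x"
    and sub: "\<And>r. 0 \<le> r \<Longrightarrow> A r \<subseteq> (\<Union>s\<in>{0..}. B s)"
  shows "\<exists>C>0. \<forall>r>0. A r \<subseteq> B (C * r)"
proof (rule ccontr)
  interpret A: ball_family A by fact
  interpret B: ball_family B by fact
  assume neg: "\<not> ?thesis"
  have unb: "\<not> A 1 \<subseteq> B C" if C: "0 \<le> C" for C
  proof
    assume *: "A 1 \<subseteq> B C"
    have "A r \<subseteq> B ((C + 1) * r)" if r: "0 < r" for r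
    proof
      fix h assume "h \<in> A r"
      then have "(\<lambda>x. complex_of_real (1 / r) * h x) \<in> A (cmod (complex_of_real (1 / r)) * r)"
        using r by (intro A.scale) auto
      moreover have "cmod (complex_of_real (1 / r)) * r = 1" using r by (simp add: norm_divide)
      ultimately have "(\<lambda>x. complex_of_real (1 / r) * h x) \<in> B C" using * by (metis subsetD)
      then have "(\<lambda>x. complex_of_real r * (complex_of_real (1 / r) * h x)) \<in> B (cmod (complex_of_real r) * C)"
        using C by (intro B.scale)
      moreover have "B (r * C) \<subseteq> B ((C + 1) * r)"
        using C r by (intro B.mono) (auto simp: algebra_simps)
      ultimately show "h \<in> B ((C + 1) * r)" using r by auto
    qed
    then show False using neg C by (metis add_nonneg_pos zero_less_one)
  qed
  \<comment> \<open>If all perturbations of \<open>s\<close> by elements of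
    \<open>A \<delta>\<close> stayed in \<open>B (real n)\<close>, then subtracting \<open>s\<close>
    and dividing by \<open>\<delta>\<close> would bound the whole of \<open>A 1\<close>.\<close>
  have step1: "\<exists>u\<in>A \<delta>. (\<lambda>x. s x + u x) \<notin> B (real n)" if st: "s \<in> A r" "0 \<le> r" "0 < \<delta>" for s r \<delta> n
  proof (rule ccontr)
    assume "\<not> ?thesis"
    then have *: "\<And>u. u \<in> A \<delta> \<Longrightarrow> (\<lambda>x. s x + u x) \<in> B (real n)" by blast
    obtain m where m: "0 \<le> m" "s \<in> B m" using sub[OF st(2)] st(1) by auto
    have "A 1 \<subseteq> B ((1 / \<delta>) * (m + real n))"
    proof
      fix h assume "h \<in> A 1"
      then have "(\<lambda>x. complex_of_real \<delta> * h x) \<in> A \<delta>" using A.scale[of 1 h "complex_of_real \<delta>"] st by simp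
      then have "(\<lambda>x. s x + complex_of_real \<delta> * h x) \<in> B (real n)" by (rule *)
      moreover have "(\<lambda>x. - 1 * s x) \<in> B m" using B.scale[OF m, of "- 1"] by simp
      ultimately have "(\<lambda>x. - 1 * s x + (s x + complex_of_real \<delta> * h x)) \<in> B (m + real n)"
        using m by (intro B.add) auto
      then have "(\<lambda>x. complex_of_real (1 / \<delta>) * (- 1 * s x + (s x + complex_of_real \<delta> * h x)))
          \<in> B (cmod (complex_of_real (1 / \<delta>)) * (m + real n))"
        using m by (intro B.scale) auto
      moreover have "(\<lambda>x. complex_of_real (1 / \<delta>) * (- 1 * s x + (s x + complex_of_real \<delta> * h x))) = h"
        using st(3) by auto
      moreover have "cmod (complex_of_real (1 / \<delta>)) = 1 / \<delta>" using st(3) by (simp only: norm_of_real) simp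
      ultimately show "h \<in> B ((1 / \<delta>) * (m + real n))" by metis
    qed
    then show False using unb[of "(1 / \<delta>) * (m + real n)"] m st(3) by simp
  qed
  \<comment> \<open>Lying outside \<open>B (real n)\<close> is stable: elements of small
    \<open>A\<close>-balls are pointwise small by \<open>bound\<close>, and
    \<open>B (real n)\<close> is closed under pointwise limits.\<close>
  have step2: "\<exists>\<delta>>0. \<forall>u\<in>A \<delta>. (\<lambda>x. s x + u x) \<notin> B (real n)" if "s \<notin> B (real n)" for s n
  proof (rule ccontr)
    assume "\<not> ?thesis"
    then have "\<exists>u. u \<in> A (1 / (real j + 1)) \<and> (\<lambda>x. s x + u x) \<in> B (real n)" for j
      by (metis add_nonneg_pos divide_pos_pos of_nat_0_le_iff zero_less_one)
    then obtain U where U: "\<And>j. U j \<in> A (1 / (real j + 1))" "\<And>j. (\<lambda>x. s x + U j x) \<in> B (real n)" by metis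
    have "(\<lambda>j. s x + U j x) \<longlonglongrightarrow> s x" for x
    proof -
      have "(\<lambda>j. k x * inverse (real (Suc j))) \<longlonglongrightarrow> k x * 0"
        by (intro tendsto_intros LIMSEQ_inverse_real_of_nat)
      then have "(\<lambda>j. 1 / (real j + 1) * k x) \<longlonglongrightarrow> 0"
        by (simp add: field_simps)
      then have "(\<lambda>j. U j x) \<longlonglongrightarrow> 0"
        by (rule Lim_null_comparison[rotated]) (use bound[OF _ U(1)] in \<open>auto intro!: always_eventually\<close>)
      then show ?thesis using tendsto_add[OF tendsto_const[of "s x"]] by fastforce
    qed
    then have "s \<in> B (real n)" using B.closed[of "real n" "\<lambda>j x. s x + U j x" s] U(2) by auto
    then show False using that by simp
  qed
  \<comment> \<open>A state is a partial sum with the total size of the perturbations still to come.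
    Each increment is paid from this budget, at most half of which remains, and no perturbation
    within the remainder re-enters \<open>B (real n)\<close>.\<close>
  define Pr where "Pr = (\<lambda>(n::nat) (w :: ('a \<Rightarrow> complex) \<times> real). fst w \<in> (\<Union>r\<in>{0..}. A r) \<and> 0 < snd w)"
  define Qr where "Qr = (\<lambda>n (w :: ('a \<Rightarrow> complex) \<times> real) (w' :: ('a \<Rightarrow> complex) \<times> real).
     (\<lambda>x. fst w' x - fst w x) \<in> A (snd w - snd w') \<and> snd w' \<le> snd w \<and> snd w' \<le> snd w / 2 \<and>
     (\<forall>u\<in>A (snd w'). (\<lambda>x. fst w' x + u x) \<notin> B (real n)))"
  have "\<exists>f. \<forall>n. Pr n (f n) \<and> Qr n (f n) (f (Suc n))"
  proof (rule dependent_nat_choice)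
    show "\<exists>w. Pr 0 w" using A.zero by (intro exI[of _ "(\<lambda>_. 0, 1)"]) (auto simp: Pr_def)
  next
    fix w n assume w: "Pr n w"
    then obtain r where r: "0 \<le> r" "fst w \<in> A r" and \<delta>: "0 < snd w" by (auto simp: Pr_def)
    obtain u where u: "u \<in> A (snd w / 2)" "(\<lambda>x. fst w x + u x) \<notin> B (real n)"
      using step1[OF r(2,1), of "snd w / 2" n] \<delta> by auto
    obtain d where d: "0 < d" "\<And>v. v \<in> A d \<Longrightarrow> (\<lambda>x. (fst w x + u x) + v x) \<notin> B (real n)"
      using step2[OF u(2)] by blast
    define d' where "d' = min d (snd w / 2)"
    have d': "0 < d'" "d' \<le> d" "d' \<le> snd w / 2" using d \<delta> by (auto simp: d'_def)
    have 1: "(\<lambda>x. fst w x + u x) \<in> A (r + snd w / 2)" using r u \<delta> by (intro A.add) auto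
    have 2: "u \<in> A (snd w - d')" using A.mono[of "snd w / 2" "snd w - d'"] u(1) \<delta> d' by auto
    have 3: "A d' \<subseteq> A d" using A.mono[of d' d] d' by simp
    show "\<exists>w'. Pr (Suc n) w' \<and> Qr n w w'"
    proof (intro exI conjI)
      show "Pr (Suc n) (\<lambda>x. fst w x + u x, d')" using 1 r \<delta> d' by (auto simp: Pr_def intro!: bexI[of _ "r + snd w / 2"])
      show "Qr n w (\<lambda>x. fst w x + u x, d')" using 2 3 d d' \<delta> by (auto simp: Qr_def)
    qed
  qed
  then obtain f where f: "\<And>n. Pr n (f n)" "\<And>n. Qr n (f n) (f (Suc n))" by blast
  define S where "S n = fst (f n)" for n
  define D where "D n = snd (f n)" for n
  have D0: "0 < D n" for n using f(1)[of n] by (simp add: Pr_def D_def)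
  have S_step: "(\<lambda>x. S (Suc n) x - S n x) \<in> A (D n - D (Suc n))" and D_step: "D (Suc n) \<le> D n"
    and hump: "\<And>u. u \<in> A (D (Suc n)) \<Longrightarrow> (\<lambda>x. S (Suc n) x + u x) \<notin> B (real n)" for n
    using f(2)[of n] by (auto simp: Qr_def S_def D_def)
  have dec: "decseq D" using D_step by (simp add: decseq_SucI)
  have tel: "(\<lambda>x. S (n + j) x - S n x) \<in> A (D n - D (n + j))" for n j
  proof (induction j)
    case 0 then show ?case using A.zero by simp
  next
    case (Suc j)
    have "(\<lambda>x. (S (n + j) x - S n x) + (S (Suc (n + j)) x - S (n + j) x)) \<in> A ((D n - D (n + j)) + (D (n + j) - D (Suc (n + j))))"
      using dec D_step by (intro A.add Suc S_step) (auto simp: decseq_def)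
    then show ?case by simp
  qed
  have Dc: "Cauchy D"
    using decseq_convergent[OF dec, of 0] D0 by (meson LIMSEQ_imp_Cauchy less_imp_le)
  have "Cauchy (\<lambda>n. S n x)" for x
  proof (rule CauchyI')
    fix e :: real assume e: "0 < e"
    have "0 < e / (\<bar>k x\<bar> + 1)" using e by simp
    from CauchyD[OF Dc this] obtain M where M: "\<And>m n. M \<le> m \<Longrightarrow> M \<le> n \<Longrightarrow> norm (D m - D n) < e / (\<bar>k x\<bar> + 1)" by blast
    show "\<exists>M. \<forall>m\<ge>M. \<forall>n>m. dist (S m x) (S n x) < e"
    proof (intro exI[of _ M] allI impI)
      fix m n :: nat assume mn: "M \<le> m" "m < n"
      have d: "0 \<le> D m - D n" using dec mn by (simp add: decseq_def)
      have "dist (S m x) (S n x) \<le> (D m - D n) * k x"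
        using bound[OF d, of "\<lambda>x. S n x - S m x" x] tel[of m "n - m"] mn by (simp add: dist_norm norm_minus_commute)
      also have "\<dots> \<le> (D m - D n) * (\<bar>k x\<bar> + 1)" using d by (intro mult_left_mono) auto
      also have "\<dots> < e / (\<bar>k x\<bar> + 1) * (\<bar>k x\<bar> + 1)"
        using M[of m n] mn d by (intro mult_strict_right_mono) auto
      also have "\<dots> = e" by (simp add: add_nonneg_pos less_imp_neq[symmetric])
      finally show "dist (S m x) (S n x) < e" .
    qed
  qed
  then have "\<exists>y. (\<lambda>n. S n x) \<longlonglongrightarrow> y" for x
    using Cauchy_convergent convergent_def by blast
  then obtain l where l: "\<And>x. (\<lambda>n. S n x) \<longlonglongrightarrow> l x" by metis
  \<comment> \<open>The limit differs from each partial sum by no more than the remaining budget,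
    hence avoids every \<open>B (real n)\<close>; but it lies in some \<open>A\<close>-ball, which
    the union of the \<open>B\<close>-balls contains.\<close>
  have tail: "(\<lambda>x. l x - S n x) \<in> A (D n)" for n
  proof (rule A.closed)
    show "0 \<le> D n" using D0[of n] by simp
    show "(\<lambda>x. S (n + j) x - S n x) \<in> A (D n)" for j
      using tel[of n j] A.mono[of "D n - D (n + j)" "D n"] D0[of "n + j"] dec by (auto simp: decseq_def)
    show "(\<lambda>j. S (n + j) x - S n x) \<longlonglongrightarrow> l x - S n x" for x
      using LIMSEQ_ignore_initial_segment[OF l[of x], of n] by (intro tendsto_diff tendsto_const) (simp add: add.commute)
  qed
  have "l \<notin> B (real n)" for n
    using hump[OF tail[of "Suc n"]] by simp
  moreover have "\<exists>n. l \<in> B (real n)"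
  proof -
    obtain r where r: "0 \<le> r" "S 0 \<in> A r" using f(1)[of 0] by (auto simp: Pr_def S_def)
    have "(\<lambda>x. S 0 x + (l x - S 0 x)) \<in> A (r + D 0)" using r tail[of 0] D0[of 0] by (intro A.add) auto
    then have "l \<in> A (r + D 0)" by simp
    then obtain s where s: "0 \<le> s" "l \<in> B s" using sub[of "r + D 0"] r D0[of 0] by auto
    obtain n :: nat where "s \<le> real n" using real_arch_simple by blast
    then show ?thesis using B.mono[of s "real n"] s by blast
  qed
  ultimately show False by blast
qed

section \<open>Balls of the kernel space and of its multiplier algebra\<close>

definition rkhs_ball :: "'a set \<Rightarrow> ('a \<Rightarrow> 'a \<Rightarrow> complex) \<Rightarrow> real \<Rightarrow> ('a \<Rightarrow> complex) set" where
  "rkhs_ball X K r = {h. (\<forall>x. x \<notin> X \<longrightarrow> h x = 0) \<and>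
     pos_kernel X (\<lambda>x y. complex_of_real (r^2) * K x y - h x * cnj (h y))}"

definition mult_ball :: "'a set \<Rightarrow> ('a \<Rightarrow> 'a \<Rightarrow> complex) \<Rightarrow> real \<Rightarrow> ('a \<Rightarrow> complex) set" where
  "mult_ball X K r = {\<phi>. (\<forall>x. x \<notin> X \<longrightarrow> \<phi> x = 0) \<and>
     pos_kernel X (\<lambda>x y. (complex_of_real (r^2) - \<phi> x * cnj (\<phi> y)) * K x y)}"

context
  fixes X :: "'a set" and K :: "'a \<Rightarrow> 'a \<Rightarrow> complex"
  assumes K: "pos_kernel X K"
begin

lemma rkhs_ball_iff:
  "0 \<le> r \<Longrightarrow> h \<in> rkhs_ball X K r \<longleftrightarrow> (\<forall>x. x \<notin> X \<longrightarrow> h x = 0) \<and>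
    (\<forall>F c. finite F \<longrightarrow> F \<subseteq> X \<longrightarrow> cmod (\<Sum>x\<in>F. c x * h x) \<le> r * knorm K F c)"
  by (simp only: rkhs_ball_def mem_Collect_eq pos_kernel_dominates_iff[OF K])

lemma mult_ball_iff:
  "0 \<le> r \<Longrightarrow> h \<in> mult_ball X K r \<longleftrightarrow> (\<forall>x. x \<notin> X \<longrightarrow> h x = 0) \<and>
    (\<forall>F c. finite F \<longrightarrow> F \<subseteq> X \<longrightarrow> knorm K F (\<lambda>x. c x * h x) \<le> r * knorm K F c)"
  by (simp only: mult_ball_def mem_Collect_eq pos_kernel_multiplier_iff[OF K])

lemma rkhs_ballD:
  "0 \<le> r \<Longrightarrow> h \<in> rkhs_ball X K r \<Longrightarrow> finite F \<Longrightarrow> F \<subseteq> X \<Longrightarrow> cmod (\<Sum>x\<in>F. c x * h x) \<le> r * knorm K F c"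
  by (simp only: rkhs_ball_iff)

lemma mult_ballD:
  "0 \<le> r \<Longrightarrow> h \<in> mult_ball X K r \<Longrightarrow> finite F \<Longrightarrow> F \<subseteq> X \<Longrightarrow> knorm K F (\<lambda>x. c x * h x) \<le> r * knorm K F c"
  by (simp only: mult_ball_iff)

lemma knorm_scale_mono:
  assumes "r \<le> s" "finite F" "F \<subseteq> X" "\<forall>F. finite F \<longrightarrow> F \<subseteq> X \<longrightarrow> (\<forall>c. q F c \<le> r * knorm K F c)"
  shows "q F c \<le> s * knorm K F c"
proof -
  have "q F c \<le> r * knorm K F c" using assms by blast
  also have "\<dots> \<le> s * knorm K F c" by (intro mult_right_mono assms knorm_nonneg[OF K])
  finally show ?thesis .
qed

lemma ball_family_rkhs_ball: "ball_family (rkhs_ball X K)"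
proof
  fix r s :: real and h k :: "'a \<Rightarrow> complex" and c :: complex
  show "0 \<le> r \<Longrightarrow> r \<le> s \<Longrightarrow> rkhs_ball X K r \<subseteq> rkhs_ball X K s"
    by (auto simp: rkhs_ball_iff intro!: knorm_scale_mono[of r s _ "\<lambda>F c. cmod (\<Sum>x\<in>F. c x * _ x)"])
  show "(\<lambda>_. 0) \<in> rkhs_ball X K 0" by (simp add: rkhs_ball_iff)
  show "(\<lambda>x. h x + k x) \<in> rkhs_ball X K (r + s)" if "0 \<le> r" "0 \<le> s" "h \<in> rkhs_ball X K r" "k \<in> rkhs_ball X K s"
    using that by (auto simp: rkhs_ball_iff distrib_left distrib_right sum.distrib intro!: order_trans[OF norm_triangle_ineq] add_mono)
  show "(\<lambda>x. c * h x) \<in> rkhs_ball X K (cmod c * r)" if "0 \<le> r" "h \<in> rkhs_ball X K r"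
  proof -
    have "(\<Sum>x\<in>F. d x * (c * h x)) = c * (\<Sum>x\<in>F. d x * h x)" for F d
      by (simp add: sum_distrib_left mult.left_commute)
    then show ?thesis using that by (auto simp: rkhs_ball_iff norm_mult mult.assoc intro!: mult_left_mono)
  qed
  show "l \<in> rkhs_ball X K r"
    if "0 \<le> r" and H: "\<And>n. H n \<in> rkhs_ball X K r" and l: "\<And>x. (\<lambda>n. H n x) \<longlonglongrightarrow> l x" for H l
  proof -
    have "l x = 0" if "x \<notin> X" for x
      using LIMSEQ_unique[OF l[of x], of 0] H that by (simp add: rkhs_ball_def)
    moreover have "pos_kernel X (\<lambda>x y. complex_of_real (r^2) * K x y - l x * cnj (l y))"
      by (rule pos_kernel_limit[of _ "\<lambda>n x y. complex_of_real (r^2) * K x y - H n x * cnj (H n y)"])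
        (use H in \<open>auto simp: rkhs_ball_def intro!: tendsto_intros l\<close>)
    ultimately show ?thesis by (simp add: rkhs_ball_def)
  qed
qed

lemma ball_family_mult_ball: "ball_family (mult_ball X K)"
proof
  fix r s :: real and h k :: "'a \<Rightarrow> complex" and c :: complex
  show "0 \<le> r \<Longrightarrow> r \<le> s \<Longrightarrow> mult_ball X K r \<subseteq> mult_ball X K s"
    by (auto simp: mult_ball_iff intro!: knorm_scale_mono[of r s _ "\<lambda>F c. knorm K F (\<lambda>x. c x * _ x)"])
  show "(\<lambda>_. 0) \<in> mult_ball X K 0"
    using knorm_scale[of K _ 0] by (simp add: mult_ball_iff)
  show "(\<lambda>x. h x + k x) \<in> mult_ball X K (r + s)" if "0 \<le> r" "0 \<le> s" "h \<in> mult_ball X K r" "k \<in> mult_ball X K s"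
    using that by (auto simp: mult_ball_iff distrib_left distrib_right intro!: order_trans[OF knorm_add[OF K]] add_mono)
  show "(\<lambda>x. c * h x) \<in> mult_ball X K (cmod c * r)" if "0 \<le> r" "h \<in> mult_ball X K r"
  proof -
    have "(\<lambda>x. d x * (c * h x)) = (\<lambda>x. c * (d x * h x))" for d by auto
    then show ?thesis using that by (auto simp: mult_ball_iff knorm_scale mult.assoc intro!: mult_left_mono)
  qed
  show "l \<in> mult_ball X K r"
    if "0 \<le> r" and H: "\<And>n. H n \<in> mult_ball X K r" and l: "\<And>x. (\<lambda>n. H n x) \<longlonglongrightarrow> l x" for H l
  proof -
    have "l x = 0" if "x \<notin> X" for x
      using LIMSEQ_unique[OF l[of x], of 0] H that by (simp add: mult_ball_def)
    moreover have "pos_kernel X (\<lambda>x y. (complex_of_real (r^2) - l x * cnj (l y)) * K x y)"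
      by (rule pos_kernel_limit[of _ "\<lambda>n x y. (complex_of_real (r^2) - H n x * cnj (H n y)) * K x y"])
        (use H in \<open>auto simp: mult_ball_def intro!: tendsto_intros l\<close>)
    ultimately show ?thesis by (simp add: mult_ball_def)
  qed
qed

lemma mult_ball_mult:
  assumes "0 \<le> r" "0 \<le> s" "h \<in> mult_ball X K r" "k \<in> mult_ball X K s"
  shows "(\<lambda>x. h x * k x) \<in> mult_ball X K (r * s)"
proof -
  have "knorm K F (\<lambda>x. c x * (h x * k x)) \<le> r * s * knorm K F c" if F: "finite F" "F \<subseteq> X" for F c
  proof -
    have "knorm K F (\<lambda>x. (c x * h x) * k x) \<le> s * knorm K F (\<lambda>x. c x * h x)"
      by (rule mult_ballD[OF assms(2,4) F])
    also have "\<dots> \<le> s * (r * knorm K F c)"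
      by (intro mult_left_mono mult_ballD[OF assms(1,3) F] assms)
    finally show ?thesis by (simp add: mult_ac)
  qed
  then show ?thesis using assms by (auto simp: mult_ball_iff)
qed

lemma mult_ball_rkhs_ball:
  assumes "0 \<le> r" "0 \<le> s" "\<phi> \<in> mult_ball X K r" "h \<in> rkhs_ball X K s"
  shows "(\<lambda>x. \<phi> x * h x) \<in> rkhs_ball X K (r * s)"
proof -
  have "cmod (\<Sum>x\<in>F. c x * (\<phi> x * h x)) \<le> r * s * knorm K F c" if F: "finite F" "F \<subseteq> X" for F c
  proof -
    have "cmod (\<Sum>x\<in>F. (c x * \<phi> x) * h x) \<le> s * knorm K F (\<lambda>x. c x * \<phi> x)"
      by (rule rkhs_ballD[OF assms(2,4) F])
    also have "\<dots> \<le> s * (r * knorm K F c)"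
      by (intro mult_left_mono mult_ballD[OF assms(1,3) F] assms)
    finally show ?thesis by (simp add: mult_ac)
  qed
  then show ?thesis using assms by (auto simp: rkhs_ball_iff)
qed

lemma rkhs_eq: "rkhs X K = (\<Union>r\<in>{0..}. rkhs_ball X K r)"
proof (intro equalityI subsetI)
  fix h assume "h \<in> rkhs X K"
  then obtain C where "h \<in> rkhs_ball X K C" by (auto simp: rkhs_def rkhs_ball_def)
  then have "h \<in> rkhs_ball X K \<bar>C\<bar>" by (simp add: rkhs_ball_def)
  then show "h \<in> (\<Union>r\<in>{0..}. rkhs_ball X K r)" by auto
qed (auto simp: rkhs_def rkhs_ball_def)

lemma rkhs_ball_bound:
  assumes "0 \<le> r" "h \<in> rkhs_ball X K r"
  shows "cmod (h x) \<le> r * (if x \<in> X then knorm K {x} (\<lambda>_. 1) else 0)"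
proof (cases "x \<in> X")
  case True
  then have "cmod (\<Sum>x\<in>{x}. 1 * h x) \<le> r * knorm K {x} (\<lambda>_. 1)"
    by (intro rkhs_ballD[OF assms]) auto
  then show ?thesis using True by simp
qed (use assms in \<open>auto simp: rkhs_ball_def\<close>)

text \<open>The kernel function at \<open>x\<close> is an eigenvector of the adjoint of
  multiplication, with eigenvalue the conjugate of \<open>\<phi> x\<close>.\<close>

lemma mult_ball_bound:
  assumes "0 \<le> r" "\<phi> \<in> mult_ball X K r" "x \<in> X \<Longrightarrow> K x x \<noteq> 0"
  shows "cmod (\<phi> x) \<le> r"
proof (cases "x \<in> X")
  case True
  have "knorm K {x} (\<lambda>y. 1 * \<phi> y) \<le> r * knorm K {x} (\<lambda>_. 1)"
    using True by (intro mult_ballD[OF assms(1,2)]) auto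
  moreover have "knorm K {x} (\<lambda>y. 1 * \<phi> y) = knorm K {x} (\<lambda>y. \<phi> x * 1)"
    by (simp add: knorm_def kform_def)
  moreover have "0 < knorm K {x} (\<lambda>_. 1)"
    using assms(3) pos_kernel_diag[OF K True] True
    by (auto simp: knorm_def kform_def complex_nonneg_Reals_iff complex_eq_iff)
  ultimately show ?thesis unfolding knorm_scale by simp
qed (use assms in \<open>auto simp: mult_ball_def\<close>)

text \<open>The converse of \<open>mult_ball_rkhs_ball\<close>: the action on the unit ball already
  bounds the adjoint, since a functional can be tested on a vector at which it attains its
  norm.\<close>

lemma mult_ballI:
  assumes r: "0 \<le> r" and z: "\<And>x. x \<notin> X \<Longrightarrow> \<phi> x = 0"
    and m: "\<And>h. h \<in> rkhs_ball X K 1 \<Longrightarrow> (\<lambda>x. \<phi> x * h x) \<in> rkhs_ball X K r"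
  shows "\<phi> \<in> mult_ball X K r"
proof -
  have "knorm K F (\<lambda>x. c x * \<phi> x) \<le> r * knorm K F c" if F: "finite F" "F \<subseteq> X" for F c
  proof (cases "knorm K F (\<lambda>x. c x * \<phi> x) = 0")
    case True then show ?thesis using r knorm_nonneg[OF K F] by simp
  next
    case False
    define d where "d x = (if x \<in> F then c x * \<phi> x else 0)" for x
    define q where "q = knorm K F (\<lambda>x. c x * \<phi> x)"
    have q: "0 < q" using False knorm_nonneg[OF K F] by (simp add: q_def order_less_le)
    have dq: "knorm K F d = q" unfolding q_def knorm_def kform_def by (simp add: d_def cong: sum.cong)
    \<comment> \<open>The unit vector at which the functional with coefficients \<open>d\<close>
      takes its norm \<open>q\<close>; its expansion in kernel functions makes the pairing a value
      of \<open>kform\<close>.\<close>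
    define h where "h x = (if x \<in> X then (\<Sum>y\<in>F. cnj (d y) * K x y) / complex_of_real q else 0)" for x
    have dh: "(\<Sum>x\<in>G. e x * h x) = kform K F' (\<lambda>x. if x \<in> G then e x else 0) d / complex_of_real q"
      if "finite F'" "F \<subseteq> F'" "G \<subseteq> F'" "F' \<subseteq> X" for G F' e
    proof -
      have "kform K F' (\<lambda>x. if x \<in> G then e x else 0) d
          = (\<Sum>x\<in>F'. (if x \<in> G then e x else 0) * (\<Sum>y\<in>F'. cnj (d y) * K x y))"
        by (simp add: kform_def sum_distrib_left mult.assoc)
      also have "\<dots> = (\<Sum>x\<in>G. (if x \<in> G then e x else 0) * (\<Sum>y\<in>F'. cnj (d y) * K x y))"
        using that by (intro sum.mono_neutral_right) auto
      also have "\<dots> = (\<Sum>x\<in>G. e x * (\<Sum>y\<in>F. cnj (d y) * K x y))"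
      proof (rule sum.cong[OF refl])
        fix x assume "x \<in> G"
        moreover have "(\<Sum>y\<in>F'. cnj (d y) * K x y) = (\<Sum>y\<in>F. cnj (d y) * K x y)"
          using that by (intro sum.mono_neutral_right) (auto simp: d_def)
        ultimately show "(if x \<in> G then e x else 0) * (\<Sum>y\<in>F'. cnj (d y) * K x y) = e x * (\<Sum>y\<in>F. cnj (d y) * K x y)"
          by simp
      qed
      also have "\<dots> / complex_of_real q = (\<Sum>x\<in>G. e x * h x)"
        unfolding sum_divide_distrib
      proof (rule sum.cong[OF refl])
        fix x assume "x \<in> G"
        then have "x \<in> X" using that by blast
        then show "e x * (\<Sum>y\<in>F. cnj (d y) * K x y) / complex_of_real q = e x * h x" by (simp add: h_def)
      qed
      finally show ?thesis by simp
    qed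
    have "h \<in> rkhs_ball X K 1"
    proof -
      have "cmod (\<Sum>x\<in>G. e x * h x) \<le> knorm K G e" if G: "finite G" "G \<subseteq> X" for G e
      proof -
        let ?e = "\<lambda>x. if x \<in> G then e x else 0"
        have U: "finite (F \<union> G)" "F \<union> G \<subseteq> X" using F G by auto
        have n1: "knorm K (F \<union> G) d = q"
          using kform_mono_neutral[of "F \<union> G" F d d K] U dq by (simp add: knorm_def d_def)
        have "kform K (F \<union> G) ?e ?e = kform K G ?e ?e" using U by (intro kform_mono_neutral) auto
        also have "\<dots> = kform K G e e" unfolding kform_def by (intro sum.cong refl) simp
        finally have n2: "knorm K (F \<union> G) ?e = knorm K G e" by (simp add: knorm_def)
        have "cmod (\<Sum>x\<in>G. e x * h x) = cmod (kform K (F \<union> G) ?e d) / q"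
          using dh[of "F \<union> G" G e] U q by (simp add: norm_divide)
        also have "\<dots> \<le> (knorm K G e * q) / q"
          using cmod_kform_le[OF K U, of ?e d] n1 n2 q by (intro divide_right_mono) auto
        finally show ?thesis using q by simp
      qed
      then show ?thesis by (simp add: rkhs_ball_iff h_def)
    qed
    from m[OF this] have "cmod (\<Sum>x\<in>F. c x * (\<phi> x * h x)) \<le> r * knorm K F c"
      by (rule rkhs_ballD[OF r _ F])
    also have "(\<Sum>x\<in>F. c x * (\<phi> x * h x)) = (\<Sum>x\<in>F. d x * h x)"
      by (intro sum.cong refl) (simp add: d_def)
    also have "\<dots> = kform K F (\<lambda>x. if x \<in> F then d x else 0) d / complex_of_real q"
      using F by (intro dh) auto
    also have "(\<lambda>x. if x \<in> F then d x else 0) = d" by (auto simp: d_def)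
    also have "kform K F d d = complex_of_real (q\<^sup>2)" using kform_eq_knorm[OF K F, of d] dq by simp
    also have "cmod (complex_of_real (q\<^sup>2) / complex_of_real q) = q"
      using q by (simp add: power2_eq_square norm_mult)
    finally show ?thesis by (simp add: q_def)
  qed
  then show ?thesis using r z by (simp add: mult_ball_iff)
qed

text \<open>A function that merely maps the kernel space into itself is automatically a bounded
  multiplier: the closed graph theorem is applied to the unit ball and to the functions whose
  product with \<open>\<phi>\<close> lies in a ball.\<close>

lemma mult_alg_eq: "mult_alg X K = (\<Union>r\<in>{0..}. mult_ball X K r)"
proof (intro equalityI subsetI)
  fix \<phi> assume "\<phi> \<in> (\<Union>r\<in>{0..}. mult_ball X K r)"
  then obtain r where r: "0 \<le> r" "\<phi> \<in> mult_ball X K r" by auto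
  then have "(\<lambda>x. \<phi> x * h x) \<in> rkhs X K" if "h \<in> rkhs X K" for h
    using that mult_ball_rkhs_ball[of r _ \<phi> h] mult_nonneg_nonneg[of r]
    unfolding rkhs_eq by (metis UN_iff atLeast_iff)
  then show "\<phi> \<in> mult_alg X K" using r by (simp add: mult_alg_def mult_ball_def)
next
  fix \<phi> assume \<phi>: "\<phi> \<in> mult_alg X K"
  define B where "B r = {h. (\<forall>x. x \<notin> X \<longrightarrow> h x = 0) \<and> (\<lambda>x. \<phi> x * h x) \<in> rkhs_ball X K r}" for r
  interpret R: ball_family "rkhs_ball X K" by (rule ball_family_rkhs_ball)
  have "ball_family B"
  proof
    fix r s :: real and h k :: "'a \<Rightarrow> complex" and c :: complex
    show "0 \<le> r \<Longrightarrow> r \<le> s \<Longrightarrow> B r \<subseteq> B s" using R.mono[of r s] by (auto simp: B_def)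
    show "(\<lambda>_. 0) \<in> B 0" using R.zero by (simp add: B_def)
    show "(\<lambda>x. h x + k x) \<in> B (r + s)" if "0 \<le> r" "0 \<le> s" "h \<in> B r" "k \<in> B s"
      using R.add[of r s "\<lambda>x. \<phi> x * h x" "\<lambda>x. \<phi> x * k x"] that by (simp add: B_def distrib_left)
    show "(\<lambda>x. c * h x) \<in> B (cmod c * r)" if "0 \<le> r" "h \<in> B r"
      using R.scale[of r "\<lambda>x. \<phi> x * h x" c] that by (simp add: B_def mult.left_commute)
    show "l \<in> B r" if "0 \<le> r" and H: "\<And>n. H n \<in> B r" and l: "\<And>x. (\<lambda>n. H n x) \<longlonglongrightarrow> l x" for H l
    proof -
      have "l x = 0" if "x \<notin> X" for x
        using LIMSEQ_unique[OF l[of x], of 0] H that by (simp add: B_def)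
      moreover have "(\<lambda>x. \<phi> x * l x) \<in> rkhs_ball X K r"
      proof (rule R.closed[OF \<open>0 \<le> r\<close>])
        show "(\<lambda>x. \<phi> x * H n x) \<in> rkhs_ball X K r" for n using H by (simp add: B_def)
        show "(\<lambda>n. \<phi> x * H n x) \<longlonglongrightarrow> \<phi> x * l x" for x by (intro tendsto_intros l)
      qed
      ultimately show ?thesis by (simp add: B_def)
    qed
  qed
  moreover have "rkhs_ball X K r \<subseteq> (\<Union>s\<in>{0..}. B s)" if "0 \<le> r" for r
  proof
    fix h assume h: "h \<in> rkhs_ball X K r"
    then have "h \<in> rkhs X K" using that by (auto simp: rkhs_eq)
    then have "(\<lambda>x. \<phi> x * h x) \<in> rkhs X K" using \<phi> by (auto simp: mult_alg_def)
    then show "h \<in> (\<Union>s\<in>{0..}. B s)" using h by (auto simp: rkhs_eq B_def rkhs_ball_def)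
  qed
  ultimately have "\<exists>C>0. \<forall>r>0. rkhs_ball X K r \<subseteq> B (C * r)"
    by (intro ball_family_closed_graph[OF ball_family_rkhs_ball, where k = "\<lambda>x. if x \<in> X then knorm K {x} (\<lambda>_. 1) else 0"])
      (assumption, erule (1) rkhs_ball_bound, assumption)
  then obtain C where C: "0 < C" "\<And>r. 0 < r \<Longrightarrow> rkhs_ball X K r \<subseteq> B (C * r)" by blast
  have "\<phi> \<in> mult_ball X K C"
    using C(1) C(2)[of 1] \<phi> by (intro mult_ballI) (auto simp: B_def mult_alg_def)
  then show "\<phi> \<in> (\<Union>r\<in>{0..}. mult_ball X K r)" using C(1) by auto
qed

lemma rkhs_norm_eq: "\<forall>x. x \<notin> X \<longrightarrow> h x = 0 \<Longrightarrow> rkhs_norm X K h = Inf {C. 0 \<le> C \<and> h \<in> rkhs_ball X K C}"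
  by (simp add: rkhs_norm_def rkhs_ball_def)

lemma rkhs_norm_le:
  assumes "0 \<le> r" "h \<in> rkhs_ball X K r" shows "rkhs_norm X K h \<le> r"
proof -
  have "bdd_below {C. 0 \<le> C \<and> h \<in> rkhs_ball X K C}" by (auto intro: bdd_belowI)
  then show ?thesis using assms by (subst rkhs_norm_eq) (auto simp: rkhs_ball_def[of X K r] intro: cInf_lower)
qed

text \<open>For fixed coefficients the admissible constants form a closed condition, so the infimum
  is itself admissible.\<close>

lemma rkhs_norm_attained:
  assumes "h \<in> rkhs X K"
  shows "0 \<le> rkhs_norm X K h" "h \<in> rkhs_ball X K (rkhs_norm X K h)"
proof -
  let ?S = "{C. 0 \<le> C \<and> h \<in> rkhs_ball X K C}"
  have ne: "?S \<noteq> {}" and z: "\<forall>x. x \<notin> X \<longrightarrow> h x = 0"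
    using assms by (auto simp: rkhs_eq rkhs_ball_def)
  show n: "0 \<le> rkhs_norm X K h" unfolding rkhs_norm_eq[OF z] by (rule cInf_greatest[OF ne]) auto
  have "cmod (\<Sum>x\<in>F. c x * h x) \<le> rkhs_norm X K h * knorm K F c" if F: "finite F" "F \<subseteq> X" for F c
  proof -
    have *: "cmod (\<Sum>x\<in>F. c x * h x) \<le> C * knorm K F c" if "C \<in> ?S" for C
      using that F by (intro rkhs_ballD) auto
    show ?thesis
    proof (cases "knorm K F c = 0")
      case True then show ?thesis using * ne by fastforce
    next
      case False
      then have k: "0 < knorm K F c" using knorm_nonneg[OF K F, of c] by simp
      have "cmod (\<Sum>x\<in>F. c x * h x) / knorm K F c \<le> Inf ?S"
        using * k by (intro cInf_greatest[OF ne]) (simp add: divide_le_eq)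
      then show ?thesis using k unfolding rkhs_norm_eq[OF z] by (simp add: divide_le_eq)
    qed
  qed
  then show "h \<in> rkhs_ball X K (rkhs_norm X K h)" using n z by (simp add: rkhs_ball_iff)
qed

lemma mult_norm_set_bound:
  assumes "0 \<le> r" "\<phi> \<in> mult_ball X K r" "h \<in> rkhs X K" "rkhs_norm X K h \<le> 1"
  shows "rkhs_norm X K (\<lambda>z. \<phi> z * h z) \<le> r"
proof -
  interpret R: ball_family "rkhs_ball X K" by (rule ball_family_rkhs_ball)
  have "h \<in> rkhs_ball X K 1"
    using rkhs_norm_attained[OF assms(3)] R.mono[of "rkhs_norm X K h" 1] assms(4) by auto
  then show ?thesis using mult_ball_rkhs_ball[of r 1 \<phi> h] assms by (intro rkhs_norm_le) auto
qed

lemma zero_in_mult_norm_set: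
  "(\<lambda>_. 0) \<in> rkhs X K \<and> rkhs_norm X K (\<lambda>_. 0) = 0"
proof -
  interpret R: ball_family "rkhs_ball X K" by (rule ball_family_rkhs_ball)
  have z: "(\<lambda>_. 0) \<in> rkhs X K" using R.zero by (auto simp: rkhs_eq)
  show ?thesis using z rkhs_norm_attained(1)[OF z] rkhs_norm_le[OF _ R.zero] by auto
qed

lemma mult_norm_le:
  assumes "0 \<le> r" "\<phi> \<in> mult_ball X K r" shows "mult_norm X K \<phi> \<le> r"
  unfolding mult_norm_def
proof (rule cSup_least)
  show "{rkhs_norm X K (\<lambda>z. \<phi> z * h z) |h. h \<in> rkhs X K \<and> rkhs_norm X K h \<le> 1} \<noteq> {}"
    using zero_in_mult_norm_set by fastforce
qed (use mult_norm_set_bound[OF assms] in auto)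

lemma mult_norm_attained:
  assumes "\<phi> \<in> mult_alg X K"
  shows "0 \<le> mult_norm X K \<phi>" "\<phi> \<in> mult_ball X K (mult_norm X K \<phi>)"
proof -
  interpret R: ball_family "rkhs_ball X K" by (rule ball_family_rkhs_ball)
  obtain r where r: "0 \<le> r" "\<phi> \<in> mult_ball X K r" using assms by (auto simp: mult_alg_eq)
  let ?S = "{rkhs_norm X K (\<lambda>z. \<phi> z * h z) |h. h \<in> rkhs X K \<and> rkhs_norm X K h \<le> 1}"
  have bdd: "bdd_above ?S" using mult_norm_set_bound[OF r] by (auto intro!: bdd_aboveI)
  have "0 \<in> ?S" using zero_in_mult_norm_set by (auto intro!: exI[of _ "\<lambda>_. 0"])
  then show n: "0 \<le> mult_norm X K \<phi>" unfolding mult_norm_def using bdd by (rule cSup_upper)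
  show "\<phi> \<in> mult_ball X K (mult_norm X K \<phi>)"
  proof (rule mult_ballI[OF n])
    show "\<phi> x = 0" if "x \<notin> X" for x using assms that by (simp add: mult_alg_def)
  next
    fix h assume h: "h \<in> rkhs_ball X K 1"
    then have "h \<in> rkhs X K" unfolding rkhs_eq by (rule_tac UN_I[of 1]) auto
    moreover have "rkhs_norm X K h \<le> 1" using h by (intro rkhs_norm_le) auto
    ultimately have "rkhs_norm X K (\<lambda>z. \<phi> z * h z) \<le> mult_norm X K \<phi>" and "(\<lambda>z. \<phi> z * h z) \<in> rkhs X K"
      using assms unfolding mult_norm_def by (auto intro!: cSup_upper bdd simp: mult_alg_def)
    then show "(\<lambda>x. \<phi> x * h x) \<in> rkhs_ball X K (mult_norm X K \<phi>)"
      using rkhs_norm_attained[of "\<lambda>z. \<phi> z * h z"] R.mono by blast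
  qed
qed

end

text \<open>The diagonal condition bounds multipliers pointwise by their norm, which is what the
  closed graph theorem asks for; inclusion of the algebras supplies the rest.\<close>

lemma mult_norm_dominated:
  assumes K: "pos_kernel X K" and L: "pos_kernel X L" and diag: "\<And>x. x \<in> X \<Longrightarrow> K x x \<noteq> 0"
    and sub: "mult_alg X K \<subseteq> mult_alg X L"
  shows "\<exists>C>0. \<forall>\<phi>\<in>mult_alg X K. mult_norm X L \<phi> \<le> C * mult_norm X K \<phi>"
proof -
  interpret A: ball_family "mult_ball X K" by (rule ball_family_mult_ball[OF K])
  have "cmod (h x) \<le> r * 1" if "0 \<le> r" "h \<in> mult_ball X K r" for r h x
    using mult_ball_bound[OF K that] diag by simp
  moreover have "mult_ball X K r \<subseteq> (\<Union>s\<in>{0..}. mult_ball X L s)" if "0 \<le> r" for r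
    using sub that unfolding mult_alg_eq[OF K] mult_alg_eq[OF L] by auto
  ultimately obtain C where C: "0 < C" "\<And>r. 0 < r \<Longrightarrow> mult_ball X K r \<subseteq> mult_ball X L (C * r)"
    using ball_family_closed_graph[OF ball_family_mult_ball[OF K] ball_family_mult_ball[OF L], of "\<lambda>_. 1"]
    by blast
  have "mult_norm X L \<phi> \<le> C * mult_norm X K \<phi>" if \<phi>: "\<phi> \<in> mult_alg X K" for \<phi>
  proof (rule field_le_epsilon)
    fix e :: real assume e: "0 < e"
    \<comment> \<open>The comparison of balls holds for positive radii while the norm may be 0; the
      enlargement \<open>e / C\<close> costs exactly \<open>e\<close> after multiplication by
      \<open>C\<close>.\<close>
    let ?r = "mult_norm X K \<phi> + e / C"
    have n: "0 \<le> mult_norm X K \<phi>" and b: "\<phi> \<in> mult_ball X K (mult_norm X K \<phi>)"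
      using mult_norm_attained[OF K \<phi>] by auto
    have r: "0 < ?r" using n e C(1) by (simp add: add_nonneg_pos)
    have "\<phi> \<in> mult_ball X K ?r" using A.mono[of "mult_norm X K \<phi>" ?r] n b e C(1) by auto
    then have "\<phi> \<in> mult_ball X L (C * ?r)" using C(2)[OF r] by blast
    then have "mult_norm X L \<phi> \<le> C * ?r" using r C(1) by (intro mult_norm_le[OF L]) auto
    then show "mult_norm X L \<phi> \<le> C * mult_norm X K \<phi> + e" using C(1) by (simp add: distrib_left)
  qed
  then show ?thesis using C(1) by blast
qed

section \<open>Characters of the multiplier algebra\<close>

text \<open>Members of \<open>mult_alg\<close> vanish off \<open>X\<close>, so constants and
  coordinate functions enter it only after cutting off; the unit is
  \<open>restr X (\<lambda>_. 1)\<close>.\<close>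

definition restr :: "'a set \<Rightarrow> ('a \<Rightarrow> complex) \<Rightarrow> 'a \<Rightarrow> complex" where
  "restr X \<phi> x = (if x \<in> X then \<phi> x else 0)"

lemma mult_ball_pullback:
  assumes "\<phi> \<in> mult_ball X K r" "m ` Y \<subseteq> X"
  shows "restr Y (\<phi> \<circ> m) \<in> mult_ball Y (\<lambda>x y. K (m x) (m y)) r"
proof -
  have "pos_kernel X (\<lambda>x y. (complex_of_real (r^2) - \<phi> x * cnj (\<phi> y)) * K x y)"
    using assms(1) by (simp add: mult_ball_def)
  from pos_kernel_pullback[OF this assms(2)]
  have "pos_kernel Y (\<lambda>x y. (complex_of_real (r^2) - restr Y (\<phi> \<circ> m) x * cnj (restr Y (\<phi> \<circ> m) y)) * K (m x) (m y))"
    by (rule pos_kernel_eqI) (simp add: restr_def)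
  then show ?thesis by (simp add: mult_ball_def restr_def)
qed

text \<open>Injectivity and analyticity are left out so that one locale serves the discs, the
  composite of a disc with a self-map, and the identity of the ball.\<close>

locale ball_map =
  fixes X :: "'x set" and F :: "'x \<Rightarrow> complex ^ 'n"
  assumes F_ball: "x \<in> X \<Longrightarrow> norm (F x) < 1"
begin

abbreviation "K \<equiv> \<lambda>x y. DA_kernel (F x) (F y)"
abbreviation "Mult \<equiv> mult_alg X K"

lemma K_pos: "pos_kernel X K"
  by (rule pos_kernel_DA) (rule F_ball)

sublocale ball_family "mult_ball X K"
  by (rule ball_family_mult_ball[OF K_pos])

lemma K_diag: "x \<in> X \<Longrightarrow> K x x \<noteq> 0"
  using one_minus_cinner_nonzero[of "F x" "F x"] F_ball[of x] by (simp add: DA_kernel_def)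

lemma Mult_iff: "\<phi> \<in> Mult \<longleftrightarrow> (\<exists>r\<ge>0. \<phi> \<in> mult_ball X K r)"
  by (auto simp: mult_alg_eq[OF K_pos])

lemma Mult_off: "\<phi> \<in> Mult \<Longrightarrow> x \<notin> X \<Longrightarrow> \<phi> x = 0"
  by (simp add: mult_alg_def)

lemma Mult_add: "\<phi> \<in> Mult \<Longrightarrow> \<psi> \<in> Mult \<Longrightarrow> (\<lambda>x. \<phi> x + \<psi> x) \<in> Mult"
proof -
  assume "\<phi> \<in> Mult" "\<psi> \<in> Mult"
  then obtain r s where "0 \<le> r" "\<phi> \<in> mult_ball X K r" "0 \<le> s" "\<psi> \<in> mult_ball X K s"
    unfolding Mult_iff by blast
  then show ?thesis unfolding Mult_iff
    using add[of r s \<phi> \<psi>] by (intro exI[of _ "r + s"]) simp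
qed

lemma Mult_scale: "\<phi> \<in> Mult \<Longrightarrow> (\<lambda>x. c * \<phi> x) \<in> Mult"
proof -
  assume "\<phi> \<in> Mult"
  then obtain r where "0 \<le> r" "\<phi> \<in> mult_ball X K r" unfolding Mult_iff by blast
  then show ?thesis unfolding Mult_iff using scale[of r \<phi> c] by (intro exI[of _ "cmod c * r"]) simp
qed

lemma Mult_diff: "\<phi> \<in> Mult \<Longrightarrow> \<psi> \<in> Mult \<Longrightarrow> (\<lambda>x. \<phi> x - \<psi> x) \<in> Mult"
  using Mult_add[of \<phi> "\<lambda>x. - 1 * \<psi> x"] Mult_scale[of \<psi> "- 1"] by simp

lemma Mult_mult: "\<phi> \<in> Mult \<Longrightarrow> \<psi> \<in> Mult \<Longrightarrow> (\<lambda>x. \<phi> x * \<psi> x) \<in> Mult"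
proof -
  assume "\<phi> \<in> Mult" "\<psi> \<in> Mult"
  then obtain r s where "0 \<le> r" "\<phi> \<in> mult_ball X K r" "0 \<le> s" "\<psi> \<in> mult_ball X K s"
    unfolding Mult_iff by blast
  then show ?thesis unfolding Mult_iff
    using mult_ball_mult[OF K_pos, of r s \<phi> \<psi>] by (intro exI[of _ "r * s"]) simp
qed

lemma Mult_zero: "(\<lambda>x. 0) \<in> Mult"
  unfolding Mult_iff using zero by blast

lemma Mult_sum: "(\<And>i. i \<in> I \<Longrightarrow> \<phi> i \<in> Mult) \<Longrightarrow> (\<lambda>x. \<Sum>i\<in>I. \<phi> i x) \<in> Mult"
  by (induction I rule: infinite_finite_induct) (auto intro: Mult_add Mult_zero)

lemma Mult_one: "restr X (\<lambda>_. 1) \<in> Mult"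
proof -
  have "restr X (\<lambda>_. 1) \<in> mult_ball X K 1"
    using pos_kernel_eqI[OF pos_kernel_zero, of X] by (simp add: mult_ball_def restr_def)
  then show ?thesis unfolding Mult_iff by (intro exI[of _ 1]) auto
qed

text \<open>Writing the constant as the kernel times \<open>1 - cinner (F x) (F y)\<close>, the
  required form is Lagrange's kernel plus the constant \<open>(norm w)\<^sup>2\<close>.\<close>

lemma mult_ball_cinner: "restr X (\<lambda>x. cinner (F x) w) \<in> mult_ball X K (norm w)"
proof -
  have "pos_kernel X (\<lambda>x y. (cinner w w * cinner (F x) (F y) - cinner (F x) w * cinner w (F y)) * K x y
      + complex_of_real ((norm w)\<^sup>2) * 1)"
    by (intro pos_kernel_add pos_kernel_Lagrange K_pos pos_kernel_scale pos_kernel_one) simp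
  then have "pos_kernel X (\<lambda>x y. (complex_of_real ((norm w)\<^sup>2) -
      restr X (\<lambda>x. cinner (F x) w) x * cnj (restr X (\<lambda>x. cinner (F x) w) y)) * K x y)"
  proof (rule pos_kernel_eqI)
    fix x y assume xy: "x \<in> X" "y \<in> X"
    then have "1 - cinner (F x) (F y) \<noteq> 0"
      using one_minus_cinner_nonzero[of "F x" "F y"] F_ball by (simp add: less_imp_le)
    then have K: "complex_of_real ((norm w)\<^sup>2) * 1 = complex_of_real ((norm w)\<^sup>2) * (1 - cinner (F x) (F y)) * K x y"
      by (simp add: DA_kernel_def)
    show "(cinner w w * cinner (F x) (F y) - cinner (F x) w * cinner w (F y)) * K x y
      + complex_of_real ((norm w)\<^sup>2) * 1 = (complex_of_real ((norm w)\<^sup>2) -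
      restr X (\<lambda>x. cinner (F x) w) x * cnj (restr X (\<lambda>x. cinner (F x) w) y)) * K x y"
      unfolding K cinner_self using xy by (simp add: restr_def cnj_cinner algebra_simps)
  qed
  then show ?thesis by (simp add: mult_ball_def restr_def)
qed

lemma Mult_cinner: "restr X (\<lambda>x. cinner (F x) w) \<in> Mult"
  unfolding Mult_iff using mult_ball_cinner norm_ge_zero by blast

lemma cinner_axis: "cinner v (axis i 1) = v $ i"
proof -
  have "cinner v (axis i 1) = (\<Sum>j\<in>UNIV. if j = i then v $ j else 0)"
    unfolding cinner_def by (intro sum.cong) (auto simp: axis_def)
  then show ?thesis by simp
qed

lemma Mult_coord: "restr X (\<lambda>x. F x $ i) \<in> Mult"
  using Mult_cinner[of "axis i 1"] by (simp add: cinner_axis)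

text \<open>The estimate behind the Neumann series, without the series: \<open>d\<close> equals
  \<open>c\<close> plus \<open>d\<close> times a multiplier of norm at most \<open>norm w\<close>,
  and that term is absorbed on the left.\<close>

lemma Mult_inverse:
  assumes w: "norm w < 1"
  shows "restr X (\<lambda>x. 1 / (1 - cinner (F x) w)) \<in> Mult"
proof -
  define C where "C = 1 / (1 - norm w)"
  have C: "0 \<le> C" using w by (simp add: C_def)
  have "knorm K G (\<lambda>x. c x * restr X (\<lambda>x. 1 / (1 - cinner (F x) w)) x) \<le> C * knorm K G c"
    if G: "finite G" "G \<subseteq> X" for G c
  proof -
    define d where "d x = c x / (1 - cinner (F x) w)" for x
    let ?m = "\<lambda>x. d x * restr X (\<lambda>x. cinner (F x) w) x"
    have "1 - cinner (F x) w \<noteq> 0" if "x \<in> G" for x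
      using one_minus_cinner_nonzero[of "F x" w] F_ball[of x] G w that by auto
    then have dc: "d x = ?m x + c x" if "x \<in> G" for x
      using that G by (auto simp: d_def restr_def field_simps)
    have cong: "knorm K G u = knorm K G v" if "\<And>x. x \<in> G \<Longrightarrow> u x = v x" for u v
      unfolding knorm_def kform_def using that by (simp cong: sum.cong)
    have "knorm K G d = knorm K G (\<lambda>x. ?m x + c x)" by (rule cong) (rule dc)
    also have "\<dots> \<le> knorm K G ?m + knorm K G c" by (rule knorm_add[OF K_pos G])
    also have "knorm K G ?m \<le> norm w * knorm K G d"
      by (rule mult_ballD[OF K_pos _ mult_ball_cinner G]) simp
    finally have "(1 - norm w) * knorm K G d \<le> knorm K G c" by (simp add: algebra_simps)
    then have "knorm K G d \<le> C * knorm K G c" using w by (simp add: C_def field_simps)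
    moreover have "knorm K G (\<lambda>x. c x * restr X (\<lambda>x. 1 / (1 - cinner (F x) w)) x) = knorm K G d"
      using G by (intro cong) (auto simp: restr_def d_def)
    ultimately show ?thesis by simp
  qed
  then have "restr X (\<lambda>x. 1 / (1 - cinner (F x) w)) \<in> mult_ball X K C"
    using C by (simp add: mult_ball_iff[OF K_pos] restr_def)
  then show ?thesis unfolding Mult_iff using C by blast
qed

lemma Mult_bounded: "\<phi> \<in> Mult \<Longrightarrow> \<exists>r\<ge>0. \<forall>x. cmod (\<phi> x) \<le> r"
  unfolding Mult_iff using mult_ball_bound[OF K_pos] K_diag by blast

lemma Mult_Gleason:
  assumes \<phi>: "\<phi> \<in> Mult" and p: "p \<in> X"
  shows "\<exists>\<psi>. (\<forall>i. \<psi> i \<in> Mult) \<and>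
    (\<forall>x\<in>X. (1 - cinner (F x) (F p)) * (\<phi> x - \<phi> p) = (\<Sum>i\<in>UNIV. (F x - F p) $ i * \<psi> i x))"
proof -
  have "(\<lambda>x. \<phi> x - \<phi> p * restr X (\<lambda>_. 1) x) \<in> Mult" by (intro Mult_diff Mult_scale Mult_one \<phi>)
  then obtain r where r: "0 \<le> r" "(\<lambda>x. \<phi> x - \<phi> p * restr X (\<lambda>_. 1) x) \<in> mult_ball X K r"
    unfolding Mult_iff by blast
  \<comment> \<open>Adding 1 keeps the scaling factor positive when \<open>r\<close> is 0.\<close>
  define s where "s = r + 1"
  have s: "0 < s" using r by (simp add: s_def)
  have "mult_ball X K r \<subseteq> mult_ball X K s" using r by (intro mono) (auto simp: s_def)
  then have "(\<lambda>x. complex_of_real (1/s) * (\<phi> x - \<phi> p * restr X (\<lambda>_. 1) x)) \<in> mult_ball X K (cmod (complex_of_real (1/s)) * s)"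
    using r s by (intro scale) auto
  moreover have "cmod (complex_of_real (1/s)) * s = 1" using s by (simp add: norm_divide)
  ultimately have "(\<lambda>x. complex_of_real (1/s) * (\<phi> x - \<phi> p * restr X (\<lambda>_. 1) x)) \<in> mult_ball X K 1"
    by metis
  then have "pos_kernel X (\<lambda>x y. (1 - (complex_of_real (1/s) * (\<phi> x - \<phi> p * restr X (\<lambda>_. 1) x)) *
      cnj (complex_of_real (1/s) * (\<phi> y - \<phi> p * restr X (\<lambda>_. 1) y))) * K x y)"
    unfolding mult_ball_def by simp
  then have "pos_kernel X (\<lambda>x y. (1 - (complex_of_real (1/s) * (\<phi> x - \<phi> p)) * cnj (complex_of_real (1/s) * (\<phi> y - \<phi> p))) * K x y)"
    by (rule pos_kernel_eqI) (simp add: restr_def)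
  then have "\<exists>\<psi>. (\<forall>x\<in>X. (1 - cinner (F x) (F p)) * (complex_of_real (1/s) * (\<phi> x - \<phi> p)) = (\<Sum>i\<in>UNIV. (F x - F p) $ i * \<psi> i x)) \<and>
      (\<forall>i. pos_kernel X (\<lambda>x y. (1 - \<psi> i x * cnj (\<psi> i y)) * K x y))"
    by (rule DA_Gleason[OF F_ball p, rotated -1]) simp_all
  then obtain \<psi> where \<psi>: "\<And>x. x \<in> X \<Longrightarrow> (1 - cinner (F x) (F p)) * (complex_of_real (1/s) * (\<phi> x - \<phi> p))
       = (\<Sum>i\<in>UNIV. (F x - F p) $ i * \<psi> i x)"
    and pos: "\<And>i. pos_kernel X (\<lambda>x y. (1 - \<psi> i x * cnj (\<psi> i y)) * K x y)"
    by blast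
  have \<psi>M: "restr X (\<psi> i) \<in> Mult" for i
  proof -
    have "pos_kernel X (\<lambda>x y. (1 - restr X (\<psi> i) x * cnj (restr X (\<psi> i) y)) * K x y)"
      by (rule pos_kernel_eqI[OF pos[of i]]) (simp add: restr_def)
    then have "restr X (\<psi> i) \<in> mult_ball X K 1" by (simp add: mult_ball_def restr_def)
    then show ?thesis unfolding Mult_iff by (intro exI[of _ 1]) auto
  qed
  have "(1 - cinner (F x) (F p)) * (\<phi> x - \<phi> p) =
      (\<Sum>i\<in>UNIV. (F x - F p) $ i * (complex_of_real s * restr X (\<psi> i) x))" if x: "x \<in> X" for x
  proof -
    have "(1 - cinner (F x) (F p)) * (\<phi> x - \<phi> p)
      = complex_of_real s * ((1 - cinner (F x) (F p)) * (complex_of_real (1/s) * (\<phi> x - \<phi> p)))"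
      using s by simp
    also have "\<dots> = (\<Sum>i\<in>UNIV. (F x - F p) $ i * (complex_of_real s * restr X (\<psi> i) x))"
      unfolding \<psi>[OF x] using x by (simp add: sum_distrib_left restr_def mult_ac)
    finally show ?thesis .
  qed
  then show ?thesis using Mult_scale[OF \<psi>M]
    by (intro exI[of _ "\<lambda>i x. complex_of_real s * restr X (\<psi> i) x"]) simp
qed

end

section \<open>Characters and the points of the closed ball below them\<close>

locale ball_map_character = ball_map X F for X :: "'x set" and F :: "'x \<Rightarrow> complex ^ 'n" +
  fixes \<rho> :: "('x \<Rightarrow> complex) \<Rightarrow> complex"
  assumes \<rho>_add: "\<phi> \<in> Mult \<Longrightarrow> \<psi> \<in> Mult \<Longrightarrow> \<rho> (\<lambda>x. \<phi> x + \<psi> x) = \<rho> \<phi> + \<rho> \<psi>"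
    and \<rho>_scale: "\<phi> \<in> Mult \<Longrightarrow> \<rho> (\<lambda>x. c * \<phi> x) = c * \<rho> \<phi>"
    and \<rho>_mult: "\<phi> \<in> Mult \<Longrightarrow> \<psi> \<in> Mult \<Longrightarrow> \<rho> (\<lambda>x. \<phi> x * \<psi> x) = \<rho> \<phi> * \<rho> \<psi>"
    and \<rho>_one: "\<rho> (restr X (\<lambda>_. 1)) = 1"
begin

definition point :: "complex ^ 'n" where
  "point = (\<chi> i. \<rho> (restr X (\<lambda>x. F x $ i)))"

lemma \<rho>_zero: "\<rho> (\<lambda>x. 0) = 0"
  using \<rho>_scale[OF Mult_one, of 0] by simp

lemma \<rho>_diff: "\<phi> \<in> Mult \<Longrightarrow> \<psi> \<in> Mult \<Longrightarrow> \<rho> (\<lambda>x. \<phi> x - \<psi> x) = \<rho> \<phi> - \<rho> \<psi>"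
  using \<rho>_add[of \<phi> "\<lambda>x. - 1 * \<psi> x"] \<rho>_scale[of \<psi> "- 1"] Mult_scale[of \<psi> "- 1"] by simp

lemma \<rho>_sum: "(\<And>i. i \<in> I \<Longrightarrow> \<phi> i \<in> Mult) \<Longrightarrow> \<rho> (\<lambda>x. \<Sum>i\<in>I. \<phi> i x) = (\<Sum>i\<in>I. \<rho> (\<phi> i))"
  by (induction I rule: infinite_finite_induct) (simp_all add: \<rho>_zero \<rho>_add Mult_sum)

lemma \<rho>_cinner: "\<rho> (restr X (\<lambda>x. cinner (F x) w)) = cinner point w"
proof -
  have "restr X (\<lambda>x. cinner (F x) w) = (\<lambda>x. \<Sum>i\<in>UNIV. cnj (w $ i) * restr X (\<lambda>x. F x $ i) x)"
    by (auto simp: restr_def cinner_def mult.commute)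
  then have "\<rho> (restr X (\<lambda>x. cinner (F x) w)) = (\<Sum>i\<in>UNIV. \<rho> (\<lambda>x. cnj (w $ i) * restr X (\<lambda>x. F x $ i) x))"
    by (simp only: \<rho>_sum Mult_scale Mult_coord)
  also have "\<dots> = cinner point w"
    unfolding cinner_def by (simp add: \<rho>_scale Mult_coord point_def mult.commute)
  finally show ?thesis .
qed

lemma norm_point_le: "norm point \<le> 1"
proof (rule ccontr)
  assume "\<not> norm point \<le> 1"
  then have n: "1 < norm point" by simp
  \<comment> \<open>The reflection of \<open>point\<close> in the unit sphere: it lies in the open
    ball and pairs with \<open>point\<close> to 1, so the character would annihilate an invertible
    multiplier.\<close>
  define w where "w = (1 / (norm point)\<^sup>2) *\<^sub>R point"
  have "norm w = 1 / norm point" using n by (simp add: w_def power2_eq_square)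
  then have w: "norm w < 1" using n by (simp add: divide_less_eq)
  have "cinner point w = complex_of_real (1 / (norm point)\<^sup>2) * cinner point point"
  proof -
    have "cnj (w $ i) = complex_of_real (1 / (norm point)\<^sup>2) * cnj (point $ i)" for i
      unfolding w_def vector_scaleR_component scaleR_conv_of_real[of _ "point $ i"] by simp
    then show ?thesis unfolding cinner_def sum_distrib_left by (simp only: mult.left_commute)
  qed
  also have "\<dots> = 1"
  proof -
    have "point \<noteq> 0" using n by auto
    then show ?thesis by (simp add: cinner_self)
  qed
  finally have pw: "cinner point w = 1" .
  let ?u = "\<lambda>x. restr X (\<lambda>_. 1) x - restr X (\<lambda>x. cinner (F x) w) x"
  let ?v = "restr X (\<lambda>x. 1 / (1 - cinner (F x) w))"
  have "(\<lambda>x. ?u x * ?v x) = restr X (\<lambda>_. 1)"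
  proof
    show "?u x * ?v x = restr X (\<lambda>_. 1) x" for x
      using one_minus_cinner_nonzero[of "F x" w] F_ball[of x] w by (simp add: restr_def)
  qed
  then have "1 = \<rho> ?u * \<rho> ?v"
    using \<rho>_mult[of ?u ?v] by (simp add: \<rho>_one Mult_diff Mult_one Mult_cinner Mult_inverse w)
  moreover have "\<rho> ?u = 0" by (simp add: \<rho>_diff Mult_one Mult_cinner \<rho>_one \<rho>_cinner pw)
  ultimately show False by simp
qed

text \<open>Each coordinate of \<open>F\<close> minus the same coordinate of \<open>point\<close> is
  annihilated, so the right side disappears, and the factor \<open>1 - cinner point point\<close> on
  the left is nonzero. It is not assumed that \<open>point\<close> is a value of
  \<open>F\<close>.\<close>

lemma \<rho>_eq_if_Gleason:
  assumes \<phi>: "\<phi> \<in> Mult" and \<psi>: "\<And>i. \<psi> i \<in> Mult" and n: "norm point < 1"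
    and eq: "\<And>x. x \<in> X \<Longrightarrow> (1 - cinner (F x) point) * (\<phi> x - c) = (\<Sum>i\<in>UNIV. (F x - point) $ i * \<psi> i x)"
  shows "\<rho> \<phi> = c"
proof -
  let ?e = "restr X (\<lambda>_. 1)"
  let ?L = "\<lambda>x. (?e x - restr X (\<lambda>x. cinner (F x) point) x) * (\<phi> x - c * ?e x)"
  let ?R = "\<lambda>x. \<Sum>i\<in>UNIV. (restr X (\<lambda>x. F x $ i) x - point $ i * ?e x) * \<psi> i x"
  have "?L = ?R"
  proof
    show "?L x = ?R x" for x
      using eq[of x] by (cases "x \<in> X") (simp_all add: restr_def)
  qed
  moreover have "\<rho> ?L = (1 - cinner point point) * (\<rho> \<phi> - c)"
    by (simp add: \<rho>_mult \<rho>_diff \<rho>_scale \<rho>_one \<rho>_cinner Mult_diff Mult_scale Mult_one Mult_cinner \<phi>)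
  moreover have "\<rho> ?R = (\<Sum>i\<in>UNIV. (point $ i - point $ i) * \<rho> (\<psi> i))"
    by (simp add: \<rho>_sum \<rho>_mult \<rho>_diff \<rho>_scale \<rho>_one Mult_diff Mult_scale Mult_one Mult_mult Mult_coord \<psi>)
      (simp add: point_def)
  ultimately have "(1 - cinner point point) * (\<rho> \<phi> - c) = 0" by simp
  then show ?thesis using one_minus_cinner_nonzero[of point point] n by simp
qed

lemma \<rho>_eq_eval:
  assumes "p \<in> X" "point = F p" "\<phi> \<in> Mult"
  shows "\<rho> \<phi> = \<phi> p"
proof -
  obtain \<psi> where "\<And>i. \<psi> i \<in> Mult"
    "\<And>x. x \<in> X \<Longrightarrow> (1 - cinner (F x) (F p)) * (\<phi> x - \<phi> p) = (\<Sum>i\<in>UNIV. (F x - F p) $ i * \<psi> i x)"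
    using Mult_Gleason[OF assms(3,1)] by blast
  then show ?thesis using assms F_ball[OF assms(1)] by (intro \<rho>_eq_if_Gleason[of \<phi> \<psi>]) auto
qed

text \<open>The division is carried out on the ball, at a point not yet known to lie in the image of
  \<open>F\<close>, and its quotients are composed with \<open>F\<close>. There
  \<open>\<phi>\<close> becomes the zero function, whose character value is 0.\<close>

lemma vanishes_at_point:
  assumes \<phi>: "\<phi> \<in> M_d" and z: "\<And>x. x \<in> X \<Longrightarrow> \<phi> (F x) = 0" and n: "norm point < 1"
  shows "\<phi> point = 0"
proof -
  interpret B: ball_map unit_ball "\<lambda>x :: complex ^ 'n. x"
    by unfold_locales (simp add: unit_ball_def)
  have \<phi>: "\<phi> \<in> B.Mult" using \<phi> by (simp add: M_d_def)
  have p: "point \<in> unit_ball" using n by (simp add: unit_ball_def)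
  obtain \<psi> where \<psi>: "\<And>i. \<psi> i \<in> B.Mult"
    and eq: "\<And>x. x \<in> unit_ball \<Longrightarrow> (1 - cinner x point) * (\<phi> x - \<phi> point) = (\<Sum>i\<in>UNIV. (x - point) $ i * \<psi> i x)"
    using B.Mult_Gleason[OF \<phi> p] by blast
  have FB: "F ` X \<subseteq> unit_ball" using F_ball by (auto simp: unit_ball_def)
  have "restr X (\<psi> i \<circ> F) \<in> Mult" for i
    using \<psi>[of i] mult_ball_pullback[OF _ FB, of "\<psi> i"] unfolding B.Mult_iff Mult_iff by blast
  then have "\<rho> (\<lambda>x. 0) = \<phi> point"
  proof (rule \<rho>_eq_if_Gleason[OF Mult_zero _ n])
    show "(1 - cinner (F x) point) * (0 - \<phi> point) = (\<Sum>i\<in>UNIV. (F x - point) $ i * restr X (\<psi> i \<circ> F) x)"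
      if "x \<in> X" for x using eq[of "F x"] z[OF that] FB that by (auto simp: restr_def)
  qed
  then show ?thesis by (simp add: \<rho>_zero)
qed

end

text \<open>Gleason's problem with bounded quotients gives continuity, and with continuous quotients holomorphy.\<close>

lemma (in ball_map) Mult_continuous:
  fixes p :: 'x
  assumes "\<phi> \<in> Mult" "p \<in> X" and S: "eventually (\<lambda>x. x \<in> X) G" and F: "(F \<longlongrightarrow> F p) G"
  shows "(\<phi> \<longlongrightarrow> \<phi> p) G"
proof -
  obtain \<psi> where \<psi>: "\<And>i. \<psi> i \<in> Mult"
    and eq: "\<And>x. x \<in> X \<Longrightarrow> (1 - cinner (F x) (F p)) * (\<phi> x - \<phi> p) = (\<Sum>i\<in>UNIV. (F x - F p) $ i * \<psi> i x)"
    using Mult_Gleason[OF assms(1,2)] by blast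
  have nz: "1 - cinner (F x) (F p) \<noteq> 0" if "x \<in> X" for x
    using one_minus_cinner_nonzero[of "F x" "F p"] F_ball[OF that] F_ball[OF assms(2)] by simp
  have "((\<lambda>x. (F x - F p) $ i * \<psi> i x) \<longlongrightarrow> 0) G" for i
  proof -
    obtain r where r: "\<And>x. cmod (\<psi> i x) \<le> r" using Mult_bounded[OF \<psi>[of i]] by blast
    have "((\<lambda>x. (F x - F p) $ i) \<longlongrightarrow> (F p - F p) $ i) G" by (intro tendsto_intros F)
    then have "((\<lambda>x. (F x - F p) $ i) \<longlongrightarrow> 0) G" by simp
    then show ?thesis
      using r by (intro lim_null_mult_right_bounded[where B = r]) (auto intro: always_eventually)
  qed
  then have "((\<lambda>x. \<Sum>i\<in>UNIV. (F x - F p) $ i * \<psi> i x) \<longlongrightarrow> (\<Sum>i\<in>(UNIV :: 'n set). 0)) G"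
    by (intro tendsto_sum)
  moreover have "((\<lambda>x. 1 - cinner (F x) (F p)) \<longlongrightarrow> 1 - cinner (F p) (F p)) G"
    unfolding cinner_def by (intro tendsto_intros F)
  ultimately have "((\<lambda>x. (\<Sum>i\<in>UNIV. (F x - F p) $ i * \<psi> i x) / (1 - cinner (F x) (F p)) + \<phi> p) \<longlongrightarrow>
      (\<Sum>i\<in>(UNIV :: 'n set). 0) / (1 - cinner (F p) (F p)) + \<phi> p) G"
    using nz[OF assms(2)] by (intro tendsto_add tendsto_divide tendsto_const)
  then have *: "((\<lambda>x. (\<Sum>i\<in>UNIV. (F x - F p) $ i * \<psi> i x) / (1 - cinner (F x) (F p)) + \<phi> p) \<longlongrightarrow> \<phi> p) G"
    by simp
  show ?thesis
  proof (rule Lim_transform_eventually[OF *])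
    show "\<forall>\<^sub>F x in G. (\<Sum>i\<in>UNIV. (F x - F p) $ i * \<psi> i x) / (1 - cinner (F x) (F p)) + \<phi> p = \<phi> x"
      using S
    proof eventually_elim
      case (elim x)
      show ?case unfolding eq[OF elim, symmetric] using nz[OF elim] by simp
    qed
  qed
qed

lemma ball_map_holomorphic:
  fixes f :: "complex \<Rightarrow> complex ^ 'n"
  assumes "ball_map D f" and D: "open D" and f: "\<And>i. (\<lambda>z. f z $ i) holomorphic_on D"
    and \<phi>: "\<phi> \<in> mult_alg D (\<lambda>x y. DA_kernel (f x) (f y))"
  shows "\<phi> holomorphic_on D"
proof -
  interpret ball_map D f by fact
  have "\<exists>d. (\<phi> has_field_derivative d) (at p)" if p: "p \<in> D" for p
  proof -
    obtain \<psi> where \<psi>: "\<And>i. \<psi> i \<in> Mult"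
      and eq: "\<And>x. x \<in> D \<Longrightarrow> (1 - cinner (f x) (f p)) * (\<phi> x - \<phi> p) = (\<Sum>i\<in>UNIV. (f x - f p) $ i * \<psi> i x)"
      using Mult_Gleason[OF \<phi> p] by blast
    have nz: "1 - cinner (f x) (f p) \<noteq> 0" if "x \<in> D" for x
      using one_minus_cinner_nonzero[of "f x" "f p"] F_ball[OF that] F_ball[OF p] by simp
    have ev: "\<forall>\<^sub>F x in at p. x \<in> D" using D p by (simp add: eventually_at_in_open')
    have fc: "(f \<longlongrightarrow> f p) (at p)"
      using f p D by (intro vec_tendstoI) (meson continuous_on_eq_continuous_at holomorphic_on_imp_continuous_on isContD)
    have fd: "((\<lambda>x. (f x $ i - f p $ i) / (x - p)) \<longlongrightarrow> deriv (\<lambda>z. f z $ i) p) (at p)" for i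
      using holomorphic_derivI[OF f D p] by (simp add: has_field_derivative_iff)
    have "((\<lambda>x. (\<Sum>i\<in>UNIV. (f x $ i - f p $ i) / (x - p) * \<psi> i x) / (1 - cinner (f x) (f p))) \<longlongrightarrow>
       (\<Sum>i\<in>UNIV. deriv (\<lambda>z. f z $ i) p * \<psi> i p) / (1 - cinner (f p) (f p))) (at p)"
    proof (intro tendsto_divide tendsto_sum tendsto_mult fd)
      show "(\<psi> i \<longlongrightarrow> \<psi> i p) (at p)" for i by (rule Mult_continuous[OF \<psi> p ev fc])
      show "((\<lambda>x. 1 - cinner (f x) (f p)) \<longlongrightarrow> 1 - cinner (f p) (f p)) (at p)"
        unfolding cinner_def by (intro tendsto_intros fc)
    qed (rule nz[OF p])
    then have "((\<lambda>x. (\<phi> x - \<phi> p) / (x - p)) \<longlongrightarrow>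
       (\<Sum>i\<in>UNIV. deriv (\<lambda>z. f z $ i) p * \<psi> i p) / (1 - cinner (f p) (f p))) (at p)"
    proof (rule Lim_transform_eventually)
      show "\<forall>\<^sub>F x in at p. (\<Sum>i\<in>UNIV. (f x $ i - f p $ i) / (x - p) * \<psi> i x) / (1 - cinner (f x) (f p))
          = (\<phi> x - \<phi> p) / (x - p)"
        using ev
      proof eventually_elim
        case (elim x)
        have "(\<Sum>i\<in>UNIV. (f x $ i - f p $ i) / (x - p) * \<psi> i x) = (\<Sum>i\<in>UNIV. (f x - f p) $ i * \<psi> i x) / (x - p)"
          by (simp add: sum_divide_distrib)
        also have "\<dots> = (1 - cinner (f x) (f p)) * (\<phi> x - \<phi> p) / (x - p)" by (simp only: eq[OF elim])
        finally show ?case using nz[OF elim] by simp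
      qed
    qed
    then show ?thesis by (auto simp: has_field_derivative_iff)
  qed
  then show ?thesis using D by (auto simp: holomorphic_on_open)
qed


section \<open>Isomorphisms between discs\<close>

lemma disc_kernel_eq: "disc_kernel f = (\<lambda>x y. DA_kernel (f x) (f y))"
  by (simp add: disc_kernel_def DA_kernel_def fun_eq_iff)

lemma embedding_map_ball_map: "embedding_map f V \<Longrightarrow> ball_map unit_disc f"
  unfolding embedding_map_def is_variety_def ball_map_def by (auto simp: unit_ball_def)

lemma M_of_eq: "M_of f = mult_alg unit_disc (\<lambda>x y. DA_kernel (f x) (f y))"
  by (simp add: M_of_def disc_kernel_eq)

text \<open>\<open>alg_iso\<close> does not mention the unit; it is preserved because some element
  is mapped onto the unit of the target and can be multiplied by the unit of the source.\<close>

lemma alg_iso_one: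
  assumes f: "ball_map X f" and g: "ball_map Y g"
    and iso: "alg_iso \<Phi> (mult_alg X (\<lambda>x y. DA_kernel (f x) (f y))) (mult_alg Y (\<lambda>x y. DA_kernel (g x) (g y)))"
  shows "\<Phi> (restr X (\<lambda>_. 1)) = restr Y (\<lambda>_. 1)"
proof -
  interpret f: ball_map X f by fact
  interpret g: ball_map Y g by fact
  have bij: "bij_betw \<Phi> f.Mult g.Mult" using iso by (simp add: alg_iso_def)
  have "restr Y (\<lambda>_. 1) \<in> \<Phi> ` f.Mult" using bij g.Mult_one by (simp only: bij_betw_def)
  then obtain a where a: "a \<in> f.Mult" "\<Phi> a = restr Y (\<lambda>_. 1)"
    by (elim imageE) simp
  have "\<forall>a\<in>f.Mult. \<forall>b\<in>f.Mult. \<Phi> (\<lambda>x. a x * b x) = (\<lambda>y. \<Phi> a y * \<Phi> b y)"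
    using iso unfolding alg_iso_def by (elim conjE)
  from bspec[OF bspec[OF this f.Mult_one] a(1)]
  have "\<Phi> (\<lambda>x. restr X (\<lambda>_. 1) x * a x) = (\<lambda>y. \<Phi> (restr X (\<lambda>_. 1)) y * \<Phi> a y)" .
  moreover have "(\<lambda>x. restr X (\<lambda>_. 1) x * a x) = a"
    using f.Mult_off[OF a(1)] by (auto simp: restr_def)
  ultimately have "(\<lambda>y. \<Phi> (restr X (\<lambda>_. 1)) y * \<Phi> a y) = \<Phi> a" by simp
  moreover have "\<Phi> (restr X (\<lambda>_. 1)) \<in> g.Mult" using bij f.Mult_one by (rule bij_betwE[THEN bspec])
  ultimately have "\<Phi> (restr X (\<lambda>_. 1)) y = restr Y (\<lambda>_. 1) y" for y
    using g.Mult_off[of "\<Phi> (restr X (\<lambda>_. 1))" y] fun_cong[of "\<lambda>y. \<Phi> (restr X (\<lambda>_. 1)) y * \<Phi> a y" "\<Phi> a" y]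
    by (auto simp: a(2) restr_def split: if_splits)
  then show ?thesis by blast
qed

lemma alg_iso_is_composition:
  fixes f g :: "complex \<Rightarrow> complex ^ 'n"
  assumes f: "embedding_map f V" and g: "embedding_map g W" and iso: "alg_iso \<Phi> (M_of f) (M_of g)"
  shows "\<exists>\<mu>. \<mu> ` unit_disc \<subseteq> unit_disc \<and> (\<forall>a\<in>M_of f. \<forall>z\<in>unit_disc. \<Phi> a z = a (\<mu> z))"
proof -
  have fb: "ball_map unit_disc f" and gb: "ball_map unit_disc g"
    using f g embedding_map_ball_map by blast+
  interpret f: ball_map unit_disc f by fact
  interpret g: ball_map unit_disc g by fact
  have iso': "alg_iso \<Phi> f.Mult g.Mult" using iso by (simp add: M_of_eq)
  have bij: "bij_betw \<Phi> f.Mult g.Mult" using iso' by (simp add: alg_iso_def)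
  have one: "\<Phi> (restr unit_disc (\<lambda>_. 1)) = restr unit_disc (\<lambda>_. 1)" by (rule alg_iso_one[OF fb gb iso'])
  have hol: "\<Phi> a holomorphic_on unit_disc" if "a \<in> f.Mult" for a
  proof (rule ball_map_holomorphic[OF gb])
    show "open unit_disc" by (simp add: unit_disc_def)
    show "(\<lambda>z. g z $ i) holomorphic_on unit_disc" for i using g by (simp add: embedding_map_def)
    show "\<Phi> a \<in> g.Mult" using bij that by (rule bij_betwE[THEN bspec])
  qed
  have char: "ball_map_character unit_disc f (\<lambda>a. \<Phi> a z)" if "z \<in> unit_disc" for z
  proof
    show "\<Phi> (restr unit_disc (\<lambda>_. 1)) z = 1" using that by (simp add: one restr_def)
  qed (use iso' in \<open>auto simp: alg_iso_def\<close>)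
  have "\<exists>w\<in>unit_disc. \<forall>a\<in>f.Mult. \<Phi> a z = a w" if z: "z \<in> unit_disc" for z
  proof -
    interpret \<rho>: ball_map_character unit_disc f "\<lambda>a. \<Phi> a z" by (rule char[OF z])
    have "norm \<rho>.point \<noteq> 1"
    proof
      assume n: "norm \<rho>.point = 1"
      \<comment> \<open>If the point were on the sphere, \<open>\<Phi> h\<close> would be bounded by
        1 and reach 1 at \<open>z\<close>, hence equal the unit. Injectivity of
        \<open>\<Phi>\<close> would make \<open>h\<close> the unit too, whereas its values have
        modulus below 1.\<close>
      define h where "h = restr unit_disc (\<lambda>x. cinner (f x) \<rho>.point)"
      have hM: "h \<in> f.Mult" unfolding h_def by (rule f.Mult_cinner)
      have hz: "\<Phi> h z = 1" unfolding h_def by (simp add: \<rho>.\<rho>_cinner cinner_self n)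
      have le: "cmod (\<Phi> h y) \<le> 1" if y: "y \<in> unit_disc" for y
      proof -
        interpret \<sigma>: ball_map_character unit_disc f "\<lambda>a. \<Phi> a y" by (rule char[OF y])
        have "cmod (\<Phi> h y) \<le> norm \<sigma>.point * norm \<rho>.point"
          unfolding h_def \<sigma>.\<rho>_cinner by (rule cmod_cinner_le)
        then show ?thesis using \<sigma>.norm_point_le n by simp
      qed
      have "\<Phi> h constant_on unit_disc"
      proof (rule maximum_modulus_principle[OF hol[OF hM]])
        show "cmod (\<Phi> h y) \<le> cmod (\<Phi> h z)" if "y \<in> unit_disc" for y using le[OF that] hz by simp
      qed (use z in \<open>auto simp: unit_disc_def\<close>)
      then have "\<Phi> h y = 1" if "y \<in> unit_disc" for y using hz z that unfolding constant_on_def by metis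
      moreover have "\<Phi> h \<in> g.Mult" using bij hM by (rule bij_betwE[THEN bspec])
      ultimately have "\<Phi> h = \<Phi> (restr unit_disc (\<lambda>_. 1))"
        unfolding one by (auto simp: restr_def g.Mult_off)
      then have "h = restr unit_disc (\<lambda>_. 1)"
        using bij hM f.Mult_one unfolding bij_betw_def by (meson inj_onD)
      then have "cinner (f z) \<rho>.point = 1" using z by (auto simp: h_def restr_def dest: fun_cong[of _ _ z])
      then show False using one_minus_cinner_nonzero[of "f z" \<rho>.point] f.F_ball[OF z] n by simp
    qed
    then have n: "norm \<rho>.point < 1" using \<rho>.norm_point_le by simp
    obtain S where S: "S \<subseteq> M_d" "V = {z \<in> unit_ball. \<forall>\<phi>\<in>S. \<phi> z = 0}" and V: "V = f ` unit_disc"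
      using f by (auto simp: embedding_map_def is_variety_def)
    have "\<phi> \<rho>.point = 0" if "\<phi> \<in> S" for \<phi>
    proof (rule \<rho>.vanishes_at_point[OF _ _ n])
      show "\<phi> \<in> M_d" using S that by blast
      show "\<phi> (f x) = 0" if "x \<in> unit_disc" for x using S V \<open>\<phi> \<in> S\<close> that by blast
    qed
    then have "\<rho>.point \<in> f ` unit_disc" using S(2) V n by (auto simp: unit_ball_def)
    then obtain w where "w \<in> unit_disc" "\<rho>.point = f w" by blast
    then show ?thesis using \<rho>.\<rho>_eq_eval by blast
  qed
  then obtain \<mu> where "\<And>z. z \<in> unit_disc \<Longrightarrow> \<mu> z \<in> unit_disc \<and> (\<forall>a\<in>f.Mult. \<Phi> a z = a (\<mu> z))" by metis
  then show ?thesis by (intro exI[of _ \<mu>]) (auto simp: M_of_eq)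
qed

section \<open>Inverting the isomorphism and regularity of the inducing map\<close>

lemma alg_iso_inv:
  assumes "alg_iso \<Phi> A B"
    and A: "\<And>a b. a \<in> A \<Longrightarrow> b \<in> A \<Longrightarrow> (\<lambda>z. a z + b z) \<in> A" "\<And>a c. a \<in> A \<Longrightarrow> (\<lambda>z. c * a z) \<in> A"
      "\<And>a b. a \<in> A \<Longrightarrow> b \<in> A \<Longrightarrow> (\<lambda>z. a z * b z) \<in> A"
  shows "alg_iso (inv_into A \<Phi>) B A"
proof -
  let ?\<Psi> = "inv_into A \<Phi>"
  have bij: "bij_betw \<Phi> A B" and \<Phi>: "\<And>a b. a \<in> A \<Longrightarrow> b \<in> A \<Longrightarrow> \<Phi> (\<lambda>z. a z + b z) = (\<lambda>z. \<Phi> a z + \<Phi> b z)"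
    "\<And>a c. a \<in> A \<Longrightarrow> \<Phi> (\<lambda>z. c * a z) = (\<lambda>z. c * \<Phi> a z)"
    "\<And>a b. a \<in> A \<Longrightarrow> b \<in> A \<Longrightarrow> \<Phi> (\<lambda>z. a z * b z) = (\<lambda>z. \<Phi> a z * \<Phi> b z)"
    using assms(1) by (auto simp: alg_iso_def)
  have \<Psi>: "?\<Psi> a \<in> A" "\<Phi> (?\<Psi> a) = a" if "a \<in> B" for a
    using bij that by (auto simp: bij_betw_def f_inv_into_f inv_into_into)
  have eq: "?\<Psi> a = b" if "b \<in> A" "\<Phi> b = a" for a b
    using bij that by (auto simp: bij_betw_def)
  show ?thesis
    unfolding alg_iso_def
  proof (intro conjI ballI allI)
    show "bij_betw ?\<Psi> B A" using bij by (rule bij_betw_inv_into)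
  qed (auto intro!: eq A simp: \<Phi> \<Psi>)
qed

text \<open>The inverse of an embedding map is continuous, since the map extends continuously to the closed disc and sends
  no boundary point into the open ball.\<close>

lemma embedding_map_lift_continuous:
  fixes g :: "complex \<Rightarrow> complex ^ 'n"
  assumes g: "embedding_map g W" and \<nu>: "\<nu> ` unit_disc \<subseteq> unit_disc" and w: "w \<in> unit_disc"
    and lim: "((\<lambda>y. g (\<nu> y)) \<longlongrightarrow> g (\<nu> w)) (at w)"
  shows "(\<nu> \<longlongrightarrow> \<nu> w) (at w)"
proof (rule tendstoI)
  fix e :: real assume e: "0 < e"
  let ?a = "\<nu> w"
  let ?C = "cball 0 1 - ball ?a e"
  have a: "?a \<in> unit_disc" using \<nu> w by blast
  have gc: "continuous_on (cball 0 1) g"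
  proof -
    obtain U f1 where "cball 0 1 \<subseteq> U" and d: "\<forall>x\<in>U. (g has_derivative blinfun_apply (f1 x)) (at x)"
      using g unfolding embedding_map_def C2_on_closed_disc_def by blast
    then show ?thesis
      by (intro continuous_at_imp_continuous_on) (auto intro: has_derivative_continuous)
  qed
  have ne: "g y \<noteq> g ?a" if y: "y \<in> ?C" for y
  proof
    assume eq: "g y = g ?a"
    have "norm (g ?a) \<noteq> 1" using g a by (auto simp: embedding_map_def unit_disc_def)
    moreover have "\<forall>x\<in>cball 0 1. norm (g x) = 1 \<longleftrightarrow> norm x = 1" using g by (simp add: embedding_map_def)
    then have "norm (g y) = 1 \<longleftrightarrow> norm y = 1" by (rule bspec) (use y in simp)
    ultimately have "norm y \<noteq> 1" using eq by simp
    then have "y \<in> unit_disc" using y by (auto simp: unit_disc_def)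
    then have "y = ?a" using g a eq by (auto simp: embedding_map_def inj_on_def)
    then show False using y e by simp
  qed
  \<comment> \<open>By compactness \<open>g\<close> stays a fixed distance away from its value at
    \<open>\<nu> w\<close> on the part of the closed disc far from \<open>\<nu> w\<close>; hence
    closeness of the values forces closeness of the points.\<close>
  have "\<exists>m>0. \<forall>y\<in>?C. m \<le> dist (g y) (g ?a)"
  proof (cases "?C = {}")
    case True show ?thesis unfolding True by (intro exI[of _ 1]) simp
  next
    case False
    have "compact ?C" by (intro compact_diff) auto
    moreover have "continuous_on ?C (\<lambda>y. dist (g y) (g ?a))"
      by (intro continuous_intros continuous_on_subset[OF gc]) auto
    ultimately obtain y0 where "y0 \<in> ?C" "\<And>y. y \<in> ?C \<Longrightarrow> dist (g y0) (g ?a) \<le> dist (g y) (g ?a)"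
      using continuous_attains_inf[OF _ False] by blast
    then show ?thesis using ne[of y0] by (intro exI[of _ "dist (g y0) (g ?a)"]) auto
  qed
  then obtain m where m: "0 < m" "\<And>y. y \<in> ?C \<Longrightarrow> m \<le> dist (g y) (g ?a)" by blast
  have "\<forall>\<^sub>F y in at w. y \<in> unit_disc" using w by (intro eventually_at_in_open') (auto simp: unit_disc_def)
  moreover have "\<forall>\<^sub>F y in at w. dist (g (\<nu> y)) (g ?a) < m" using lim m(1) by (rule tendstoD)
  ultimately show "\<forall>\<^sub>F y in at w. dist (\<nu> y) ?a < e"
  proof eventually_elim
    case (elim y)
    then have "\<nu> y \<notin> ?C" using m(2)[of "\<nu> y"] by linarith
    moreover have "\<nu> y \<in> unit_disc" using \<nu> elim by blast
    then have "\<nu> y \<in> cball 0 1" by (simp add: unit_disc_def)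
    ultimately show ?case by (auto simp: dist_commute)
  qed
qed

text \<open>Some component of \<open>g\<close> has nonzero derivative at \<open>\<nu> w\<close>. By
  continuity of \<open>\<nu>\<close>, the slope of that component tends to this derivative along
  \<open>\<nu>\<close> and can be divided out of the difference quotient of the composite.\<close>

lemma embedding_map_lift_holomorphic:
  fixes g :: "complex \<Rightarrow> complex ^ 'n"
  assumes g: "embedding_map g W" and \<nu>: "\<nu> ` unit_disc \<subseteq> unit_disc"
    and hol: "\<And>i. (\<lambda>w. g (\<nu> w) $ i) holomorphic_on unit_disc"
  shows "\<nu> holomorphic_on unit_disc"
proof -
  have op: "open unit_disc" by (simp add: unit_disc_def)
  have "\<exists>d. (\<nu> has_field_derivative d) (at w)" if w: "w \<in> unit_disc" for w
  proof -
    let ?a = "\<nu> w"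
    have a: "?a \<in> unit_disc" using \<nu> w by blast
    have "((\<lambda>y. g (\<nu> y)) \<longlongrightarrow> g (\<nu> w)) (at w)"
      using hol w op by (intro vec_tendstoI) (meson continuous_on_eq_continuous_at holomorphic_on_imp_continuous_on isContD)
    then have \<nu>c: "(\<nu> \<longlongrightarrow> ?a) (at w)" by (rule embedding_map_lift_continuous[OF g \<nu> w])
    obtain i where i: "deriv (\<lambda>z. g z $ i) ?a \<noteq> 0" using g a by (auto simp: embedding_map_def)
    have "((\<lambda>z. g z $ i) has_field_derivative deriv (\<lambda>z. g z $ i) ?a) (at ?a)"
      using g a op by (intro holomorphic_derivI[of _ unit_disc]) (auto simp: embedding_map_def)
    then obtain q where q: "\<And>z. g z $ i - g ?a $ i = q z * (z - ?a)" "isCont q ?a" "q ?a \<noteq> 0"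
      unfolding CARAT_DERIV using i by metis
    have qc: "((\<lambda>y. q (\<nu> y)) \<longlongrightarrow> q ?a) (at w)" by (rule isCont_tendsto_compose[OF q(2) \<nu>c])
    have "((\<lambda>y. (g (\<nu> y) $ i - g ?a $ i) / (y - w)) \<longlongrightarrow> deriv (\<lambda>w. g (\<nu> w) $ i) w) (at w)"
      using holomorphic_derivI[OF hol op w] by (simp add: has_field_derivative_iff)
    then have "((\<lambda>y. ((g (\<nu> y) $ i - g ?a $ i) / (y - w)) / q (\<nu> y)) \<longlongrightarrow> deriv (\<lambda>w. g (\<nu> w) $ i) w / q ?a) (at w)"
      by (intro tendsto_divide qc q(3))
    then have "((\<lambda>y. (\<nu> y - ?a) / (y - w)) \<longlongrightarrow> deriv (\<lambda>w. g (\<nu> w) $ i) w / q ?a) (at w)"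
    proof (rule Lim_transform_eventually)
      have "\<forall>\<^sub>F y in at w. q (\<nu> y) \<noteq> 0" using qc q(3) by (rule tendsto_imp_eventually_ne)
      then show "\<forall>\<^sub>F y in at w. ((g (\<nu> y) $ i - g ?a $ i) / (y - w)) / q (\<nu> y) = (\<nu> y - ?a) / (y - w)"
        by eventually_elim (simp add: q(1))
    qed
    then show ?thesis by (auto simp: has_field_derivative_iff)
  qed
  then show ?thesis using op by (auto simp: holomorphic_on_open)
qed

lemma M_of_compose:
  assumes \<phi>: "\<phi> \<in> M_of g" and g: "ball_map unit_disc g" and \<nu>: "\<nu> ` unit_disc \<subseteq> unit_disc"
  shows "restr unit_disc (\<phi> \<circ> \<nu>) \<in> M_of (g \<circ> \<nu>)"
proof -
  have h: "ball_map unit_disc (g \<circ> \<nu>)" using g \<nu> by (auto simp: ball_map_def)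
  show ?thesis
    using \<phi> mult_ball_pullback[OF _ \<nu>, of \<phi> "\<lambda>x y. DA_kernel (g x) (g y)"]
    unfolding M_of_eq ball_map.Mult_iff[OF g] ball_map.Mult_iff[OF h] by (auto simp: o_def)
qed

theorem theorem1p2:
  fixes f g :: "complex \<Rightarrow> complex ^ 'n"
    and V W :: "(complex ^ 'n) set"
  assumes "embedding_map f V"
    and "embedding_map g W"
    and "\<exists>\<Phi>. alg_iso \<Phi> (M_of f) (M_of g)"
  shows "\<exists>\<mu>. disc_automorphism \<mu> \<and>
           M_of f = M_of (g \<circ> \<mu>) \<and>
           (\<exists>C>0. \<forall>\<phi>\<in>M_of f. M_norm f \<phi> \<le> C * M_norm (g \<circ> \<mu>) \<phi> \<and>
                                 M_norm (g \<circ> \<mu>) \<phi> \<le> C * M_norm f \<phi>)"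
proof -
  obtain \<Phi> where iso: "alg_iso \<Phi> (M_of f) (M_of g)" using assms(3) by blast
  have fb: "ball_map unit_disc f" and gb: "ball_map unit_disc g"
    using assms embedding_map_ball_map by blast+
  interpret f: ball_map unit_disc f by fact
  interpret g: ball_map unit_disc g by fact
  define \<Psi> where "\<Psi> = inv_into (M_of f) \<Phi>"
  have iso': "alg_iso \<Psi> (M_of g) (M_of f)"
    unfolding \<Psi>_def by (rule alg_iso_inv[OF iso]) (auto simp: M_of_eq f.Mult_add f.Mult_scale f.Mult_mult)
  have bij: "bij_betw \<Phi> (M_of f) (M_of g)" using iso by (simp add: alg_iso_def)
  have \<Phi>M: "\<Phi> a \<in> M_of g" and \<Psi>\<Phi>: "\<Psi> (\<Phi> a) = a" if "a \<in> M_of f" for a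
    using bij that by (auto simp: bij_betw_def \<Psi>_def)
  have \<Psi>M: "\<Psi> b \<in> M_of f" and \<Phi>\<Psi>: "\<Phi> (\<Psi> b) = b" if "b \<in> M_of g" for b
    using bij that by (auto simp: bij_betw_def \<Psi>_def f_inv_into_f inv_into_into)
  obtain \<mu> where \<mu>: "\<mu> ` unit_disc \<subseteq> unit_disc" "\<And>a z. a \<in> M_of f \<Longrightarrow> z \<in> unit_disc \<Longrightarrow> \<Phi> a z = a (\<mu> z)"
    using alg_iso_is_composition[OF assms(1,2) iso] by blast
  obtain \<nu> where \<nu>: "\<nu> ` unit_disc \<subseteq> unit_disc" "\<And>b w. b \<in> M_of g \<Longrightarrow> w \<in> unit_disc \<Longrightarrow> \<Psi> b w = b (\<nu> w)"
    using alg_iso_is_composition[OF assms(2,1) iso'] by blast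
  have fc: "restr unit_disc (\<lambda>x. f x $ i) \<in> M_of f" and gc: "restr unit_disc (\<lambda>x. g x $ i) \<in> M_of g" for i
    unfolding M_of_eq by (rule f.Mult_coord g.Mult_coord)+
  \<comment> \<open>The coordinate functions of \<open>f\<close> are multipliers and separate points
    since \<open>f\<close> is injective; comparing them suffices.\<close>
  have \<mu>\<nu>: "\<mu> (\<nu> w) = w" if w: "w \<in> unit_disc" for w
  proof -
    have n: "\<nu> w \<in> unit_disc" and m: "\<mu> (\<nu> w) \<in> unit_disc" using w \<mu>(1) \<nu>(1) by blast+
    have "f (\<mu> (\<nu> w)) $ i = f w $ i" for i
      using \<nu>(2)[OF \<Phi>M[OF fc[of i]] w] \<mu>(2)[OF fc n, of i] \<Psi>\<Phi>[OF fc, of i] w m by (simp add: restr_def)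
    then have "f (\<mu> (\<nu> w)) = f w" by (simp add: vec_eq_iff)
    then show ?thesis using assms(1) m w by (auto simp: embedding_map_def inj_on_def)
  qed
  have \<nu>\<mu>: "\<nu> (\<mu> z) = z" if z: "z \<in> unit_disc" for z
  proof -
    have n: "\<mu> z \<in> unit_disc" and m: "\<nu> (\<mu> z) \<in> unit_disc" using z \<mu>(1) \<nu>(1) by blast+
    have "g (\<nu> (\<mu> z)) $ i = g z $ i" for i
      using \<mu>(2)[OF \<Psi>M[OF gc[of i]] z] \<nu>(2)[OF gc n, of i] \<Phi>\<Psi>[OF gc, of i] z m by (simp add: restr_def)
    then have "g (\<nu> (\<mu> z)) = g z" by (simp add: vec_eq_iff)
    then show ?thesis using assms(2) m z by (auto simp: embedding_map_def inj_on_def)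
  qed
  have "(\<lambda>w. g (\<nu> w) $ i) holomorphic_on unit_disc" for i
  proof -
    have "\<Psi> (restr unit_disc (\<lambda>x. g x $ i)) holomorphic_on unit_disc"
      using ball_map_holomorphic[OF fb] \<Psi>M[OF gc[of i]] assms(1)
      by (simp add: M_of_eq embedding_map_def unit_disc_def)
    then show ?thesis
    proof (rule holomorphic_transform)
      show "\<Psi> (restr unit_disc (\<lambda>x. g x $ i)) w = g (\<nu> w) $ i" if "w \<in> unit_disc" for w
        using \<nu>(2)[OF gc that, of i] \<nu>(1) that by (auto simp: restr_def)
    qed
  qed
  then have "\<nu> holomorphic_on unit_disc" by (rule embedding_map_lift_holomorphic[OF assms(2) \<nu>(1)])
  moreover have "bij_betw \<nu> unit_disc unit_disc"
    using \<mu>(1) \<nu>(1) \<mu>\<nu> \<nu>\<mu> by (intro bij_betw_byWitness[of _ \<mu>]) auto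
  \<comment> \<open>The automorphism sought is the map inducing the inverse isomorphism: a
    multiplier \<open>a\<close> of \<open>f\<close> equals \<open>\<Phi> a\<close> composed with
    \<open>\<nu>\<close>.\<close>
  ultimately have auto: "disc_automorphism \<nu>" by (simp add: disc_automorphism_def)
  have hb: "ball_map unit_disc (g \<circ> \<nu>)" using gb \<nu>(1) by (auto simp: ball_map_def)
  interpret h: ball_map unit_disc "g \<circ> \<nu>" by fact
  have eq: "M_of f = M_of (g \<circ> \<nu>)"
  proof (intro equalityI subsetI)
    fix a assume a: "a \<in> M_of f"
    have "restr unit_disc (\<Phi> a \<circ> \<nu>) = a"
    proof
      show "restr unit_disc (\<Phi> a \<circ> \<nu>) w = a w" for w
        using \<nu>(2)[OF \<Phi>M[OF a], of w] \<Psi>\<Phi>[OF a] a f.Mult_off[of a w] by (simp add: restr_def M_of_eq)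
    qed
    then show "a \<in> M_of (g \<circ> \<nu>)" using M_of_compose[OF \<Phi>M[OF a] gb \<nu>(1)] by simp
  next
    fix a assume a: "a \<in> M_of (g \<circ> \<nu>)"
    define b where "b = restr unit_disc (a \<circ> \<mu>)"
    have "b \<in> M_of (g \<circ> \<nu> \<circ> \<mu>)" unfolding b_def by (rule M_of_compose[OF a hb \<mu>(1)])
    \<comment> \<open>The two maps are compared only through their kernels on the disc, because
      \<open>\<nu> \<circ> \<mu>\<close> is known to be the identity only there.\<close>
    also have "M_of (g \<circ> \<nu> \<circ> \<mu>) = M_of g"
    proof -
      have "mult_ball unit_disc (\<lambda>x y. DA_kernel ((g \<circ> \<nu> \<circ> \<mu>) x) ((g \<circ> \<nu> \<circ> \<mu>) y)) r
          = mult_ball unit_disc (\<lambda>x y. DA_kernel (g x) (g y)) r" for r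
        unfolding mult_ball_def using \<nu>\<mu>
        by (intro Collect_cong conj_cong refl pos_kernel_cong) simp
      moreover have kb: "ball_map unit_disc (g \<circ> \<nu> \<circ> \<mu>)" using hb \<mu>(1) by (auto simp: ball_map_def)
      ultimately show ?thesis
        unfolding M_of_eq by (intro set_eqI) (simp only: ball_map.Mult_iff[OF kb] g.Mult_iff)
    qed
    finally have b: "b \<in> M_of g" .
    have "\<Psi> b = a"
    proof
      show "\<Psi> b w = a w" for w
      proof (cases "w \<in> unit_disc")
        case True
        then have "\<nu> w \<in> unit_disc" using \<nu>(1) by blast
        then show ?thesis using \<nu>(2)[OF b True] \<mu>\<nu>[OF True] by (simp add: b_def restr_def)
      next
        case False
        then show ?thesis using f.Mult_off[of "\<Psi> b" w] h.Mult_off[of a w] \<Psi>M[OF b] a by (simp add: M_of_eq)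
      qed
    qed
    then show "a \<in> M_of f" using \<Psi>M[OF b] by simp
  qed
  obtain C1 where C1: "0 < C1" "\<And>\<phi>. \<phi> \<in> M_of f \<Longrightarrow> M_norm (g \<circ> \<nu>) \<phi> \<le> C1 * M_norm f \<phi>"
    using mult_norm_dominated[OF f.K_pos h.K_pos f.K_diag] eq
    unfolding M_of_eq M_norm_def disc_kernel_eq by blast
  obtain C2 where C2: "0 < C2" "\<And>\<phi>. \<phi> \<in> M_of f \<Longrightarrow> M_norm f \<phi> \<le> C2 * M_norm (g \<circ> \<nu>) \<phi>"
    using mult_norm_dominated[OF h.K_pos f.K_pos h.K_diag] eq
    unfolding M_of_eq M_norm_def disc_kernel_eq by blast
  have "M_norm f \<phi> \<le> max C1 C2 * M_norm (g \<circ> \<nu>) \<phi> \<and> M_norm (g \<circ> \<nu>) \<phi> \<le> max C1 C2 * M_norm f \<phi>"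
    if \<phi>: "\<phi> \<in> M_of f" for \<phi>
  proof -
    have "0 \<le> M_norm f \<phi>" "0 \<le> M_norm (g \<circ> \<nu>) \<phi>"
      using mult_norm_attained(1)[OF f.K_pos] mult_norm_attained(1)[OF h.K_pos] \<phi> eq
      unfolding M_of_eq M_norm_def disc_kernel_eq by blast+
    then have "C1 * M_norm f \<phi> \<le> max C1 C2 * M_norm f \<phi>" "C2 * M_norm (g \<circ> \<nu>) \<phi> \<le> max C1 C2 * M_norm (g \<circ> \<nu>) \<phi>"
      by (auto intro: mult_right_mono)
    then show ?thesis using C1(2)[OF \<phi>] C2(2)[OF \<phi>] by linarith
  qed
  then have "\<exists>C>0. \<forall>\<phi>\<in>M_of f. M_norm f \<phi> \<le> C * M_norm (g \<circ> \<nu>) \<phi> \<and> M_norm (g \<circ> \<nu>) \<phi> \<le> C * M_norm f \<phi>"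
    using C1(1) by (intro exI[of _ "max C1 C2"]) (simp add: less_max_iff_disj)
  then show ?thesis using auto eq by blast
qed

end
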